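(* Let $P=(p_1,\dots,p_s)$ be a convex polygon with vertices listed in clockwise order, let $B$ be a finite set of blue points in the interior of $P$, and let $R$ be a finite set of red points outside of $P$, such that $s=|B|-|R|$ and $R\cup B\cup\{p_1,\dots,p_s\}$ is in general position (no three points collinear). Then there exists a partition of the plane into convex polygonal regions $Q_1,\dots,Q_s$, together with an assignment of each point of $R\cup B$ to exactly one region $Q_i$ containing it (points lying on the common boundary of several regions are assigned to only one of them), such that for every $i$ (indices modulo $s$) the segment $p_ip_{i+1}$ is a diagonal of $Q_i$, and the number of blue points assigned to $Q_i$ minus the number of red points assigned to $Q_i$ equals $1$.
   Context: A polygonal region is a closed, possibly unbounded, region of the plane whose boundary (possibly empty) consists of finitely many non-crossing straight-line segments or half-lines connected into a polygonal chain. A diagonal of a convex polygonal region is any segment connecting two points on its boundary. *)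

theory Defs
  imports "HOL-Analysis.Analysis"
begin

text \<open>Twice the signed area of the triangle \<open>a b c\<close>; negative iff \<open>c\<close> lies strictly to the right
  of the line directed from \<open>a\<close> to \<open>b\<close>.\<close>

definition orient :: "real^2 \<Rightarrow> real^2 \<Rightarrow> real^2 \<Rightarrow> real" where
  "orient a b c = (b$1 - a$1) * (c$2 - a$2) - (b$2 - a$2) * (c$1 - a$1)"

text \<open>The vertices are \<open>p 0, \<dots>, p (s - 1)\<close>, with indices taken modulo \<open>s\<close>.  All vertices off a side
  lie strictly to its right: this expresses convexity and the clockwise order at once, and
  makes each \<open>p i\<close> a genuine corner.  The polygon, as a closed set, is the convex hull of its
  vertices.\<close>

definition clockwise_convex_polygon :: "nat \<Rightarrow> (nat \<Rightarrow> real^2) \<Rightarrow> bool" where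
  "clockwise_convex_polygon s p \<longleftrightarrow>
     3 \<le> s \<and>
     (\<forall>i<s. \<forall>j<s. j \<noteq> i \<and> j \<noteq> (i + 1) mod s \<longrightarrow> orient (p i) (p ((i + 1) mod s)) (p j) < 0)"

definition polygon :: "nat \<Rightarrow> (nat \<Rightarrow> real^2) \<Rightarrow> (real^2) set" where
  "polygon s p = convex hull (p ` {..<s})"

definition general_position :: "(real^2) set \<Rightarrow> bool" where
  "general_position S \<longleftrightarrow>
     (\<forall>x\<in>S. \<forall>y\<in>S. \<forall>z\<in>S. x \<noteq> y \<and> y \<noteq> z \<and> x \<noteq> z \<longrightarrow> \<not> collinear {x, y, z})"

definition half_line :: "real^2 \<Rightarrow> real^2 \<Rightarrow> (real^2) set" where
  "half_line a d = {a + t *\<^sub>R d | t. 0 \<le> t}"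

text \<open>The pieces of the chain through the vertices \<open>vs\<close>, in order.  If \<open>u\<close> is \<open>Some d\<close>, the chain
  starts with the half-line from \<open>hd vs\<close> in direction \<open>d\<close>, and similarly for \<open>w\<close> at its end.
  A closed chain is one with \<open>hd vs = last vs\<close> and no half-lines.\<close>

definition chain_pieces ::
    "(real^2) option \<Rightarrow> (real^2) list \<Rightarrow> (real^2) option \<Rightarrow> (real^2) set list" where
  "chain_pieces u vs w =
     (case u of None \<Rightarrow> [] | Some d \<Rightarrow> [half_line (hd vs) d]) @
     map2 closed_segment (butlast vs) (tl vs) @
     (case w of None \<Rightarrow> [] | Some d \<Rightarrow> [half_line (last vs) d])"

definition non_crossing :: "(real^2) set list \<Rightarrow> bool" where
  "non_crossing es \<longleftrightarrow>
     (\<forall>i<length es. \<forall>j<length es. i \<noteq> j \<longrightarrow> rel_interior (es ! i) \<inter> rel_interior (es ! j) = {})"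

definition polygonal_chain :: "(real^2) set \<Rightarrow> bool" where
  "polygonal_chain C \<longleftrightarrow>
     (\<exists>u vs w. vs \<noteq> [] \<and> successively (\<noteq>) vs \<and> u \<noteq> Some 0 \<and> w \<noteq> Some 0 \<and>
        non_crossing (chain_pieces u vs w) \<and> C = \<Union> (set (chain_pieces u vs w)))"

text \<open>A closed region is the closure of a nonempty connected open set.\<close>

definition polygonal_region :: "(real^2) set \<Rightarrow> bool" where
  "polygonal_region Q \<longleftrightarrow>
     (\<exists>U. open U \<and> connected U \<and> U \<noteq> {} \<and> Q = closure U) \<and>
     (frontier Q = {} \<or> polygonal_chain (frontier Q))"

definition diagonal :: "(real^2) set \<Rightarrow> (real^2) set \<Rightarrow> bool" where
  "diagonal Q S \<longleftrightarrow> (\<exists>a\<in>frontier Q. \<exists>b\<in>frontier Q. a \<noteq> b \<and> S = closed_segment a b)"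

text \<open>The regions are closed, so neighbours share boundary points; only their interiors are
  disjoint.\<close>

definition convex_plane_partition :: "nat \<Rightarrow> (nat \<Rightarrow> (real^2) set) \<Rightarrow> bool" where
  "convex_plane_partition s Q \<longleftrightarrow>
     (\<forall>i<s. polygonal_region (Q i) \<and> convex (Q i)) \<and>
     (\<Union>i<s. Q i) = UNIV \<and>
     (\<forall>i<s. \<forall>j<s. i \<noteq> j \<longrightarrow> interior (Q i) \<inter> interior (Q j) = {})"

end

(*
  Let d i be the signed distance (up to scale) to the line through p i and p (i + 1), positive
  inside P.  For weights t i > 0 the sets Q i = {x. t i * d i x <= t j * d j x for all j} are
  convex polyhedra that partition the plane, and Q i contains side i, with its ends on the
  boundary; so only the weights have to be found.  Match the blue points with the sides and the
  red points, where giving b to side i costs ln (d i b) and giving b to r costs the minimum of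
  ln (d j b) - ln |d j r| over the sides j with d j r < 0.  An optimal matching has dual
  potentials, and those of the sides are the logarithms of suitable weights: b lies in the
  region of the side that it is matched with, and if b is matched with r, then both lie in the
  region of a minimising side j and cancel there.

  No Q i contains a line, because P is bounded; hence its boundary is one chain.  In suitable
  coordinates this is the graph of a maximum of affine functions, possibly restricted to an
  interval and continued by two parallel half-lines, or an upper and a lower graph glued at
  both ends.
*)

theory Submission
  imports Defs "HOL-Combinatorics.Cycles"
begin

section \<open>Optimal assignments and their potentials\<close>

text \<open>Logarithms make the choice of weights additive. For a blue point b, minimality of t i *
  d i b is minimality of \<tau> i + ln (d i b), which is complementary slackness in an assignment
  problem. At a red point the sign is reversed: among the sides with d j r < 0, the smallest t j * d
  j r has the largest \<tau> j + ln |d j r|. This is why pairing b with r costs a difference: b pays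
  for side j and r returns its share there. The blue points matched with these sides bound the
  potential of r from below, and the partner of r makes one of the bounds an equality. The boundary
  of a region has to be exhibited as one explicit list of segments and half-lines, so it is
  parametrised by a piecewise affine curve that is cut at its breakpoints. The recession cone of the
  region decides its shape: the cone has interior points, or is a single ray, or is trivial; a cone
  that contains a line is the case to be excluded.\<close>

fun path_weight :: "('a \<Rightarrow> 'a \<Rightarrow> real) \<Rightarrow> 'a list \<Rightarrow> real" where
  "path_weight w (x # y # zs) = w x y + path_weight w (y # zs)"
| "path_weight w zs = 0"

lemma path_weight_append:
  "path_weight w (ys @ x # zs) = path_weight w (ys @ [x]) + path_weight w (x # zs)"
  by (induction w ys rule: path_weight.induct) auto

lemma path_weight_closed:
  "ys \<noteq> [] \<Longrightarrow> path_weight w ys + w (last ys) y = sum_list (map2 w ys (tl ys @ [y]))"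
  by (induction w ys rule: path_weight.induct) auto

text \<open>Rotating a list of distinct elements by one place applies its cyclic permutation to
  every entry. Going once around a closed path therefore adds up the terms of a sum over that
  permutation.\<close>

lemma cycle_weight:
  assumes "distinct (i # ys)"
  shows "path_weight w (i # ys) + w (last (i # ys)) i
           = (\<Sum>x\<in>set (i # ys). w x (cycle_of_list (i # ys) x))"
proof -
  let ?cs = "i # ys"
  have "path_weight w ?cs + w (last ?cs) i = sum_list (map2 w ?cs (rotate1 ?cs))"
    using path_weight_closed[of ?cs w i] by simp
  also have "rotate1 ?cs = map (cycle_of_list ?cs) ?cs"
    using cyclic_rotation[OF assms, of 1] by (simp del: cycle_of_list.simps)
  also have "map2 w ?cs (map (cycle_of_list ?cs) ?cs) = map (\<lambda>x. w x (cycle_of_list ?cs x)) ?cs"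
    by (simp only: zip_map2 zip_same_conv_map map_map o_def split_conv)
  also have "sum_list \<dots> = (\<Sum>x\<in>set ?cs. w x (cycle_of_list ?cs x))"
    using assms by (rule sum_list_distinct_conv_sum_set)
  finally show ?thesis .
qed

text \<open>A cycle extended by the identity is a permutation of \<open>X\<close>, so the last
  hypothesis rules out cycles of negative weight. The least weight of a simple path that starts at
  \<open>x\<close>, with any end, is then a potential.\<close>

lemma shortest_path_potential:
  fixes w :: "'a \<Rightarrow> 'a \<Rightarrow> real"
  assumes fin: "finite X"
    and diag: "\<And>x. x \<in> X \<Longrightarrow> w x x = 0"
    and perm: "\<And>\<pi>. \<pi> permutes X \<Longrightarrow> 0 \<le> (\<Sum>x\<in>X. w x (\<pi> x))"
  obtains \<tau> :: "'a \<Rightarrow> real" where "\<And>x y. x \<in> X \<Longrightarrow> y \<in> X \<Longrightarrow> \<tau> x \<le> \<tau> y + w x y"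
proof
  define paths where "paths x = {ys. distinct (x # ys) \<and> set (x # ys) \<subseteq> X}" for x
  define \<tau> where "\<tau> x = Min ((\<lambda>ys. path_weight w (x # ys)) ` paths x)" for x
  have finp: "finite (paths x)" for x
    by (rule finite_subset[OF _ finite_subset_distinct[OF fin]]) (auto simp: paths_def)
  have le: "\<tau> x \<le> path_weight w (x # ys)" if "ys \<in> paths x" for x ys
    unfolding \<tau>_def using that finp by (intro Min_le) auto
  fix x y assume x: "x \<in> X" and y: "y \<in> X"
  have "[] \<in> paths y" using y by (simp add: paths_def)
  then have "\<tau> y \<in> (\<lambda>ys. path_weight w (y # ys)) ` paths y"
    unfolding \<tau>_def using finp by (intro Min_in) auto
  then obtain ys where ys: "ys \<in> paths y" and \<tau>y: "\<tau> y = path_weight w (y # ys)" by blast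
  show "\<tau> x \<le> \<tau> y + w x y"
  proof (cases "x \<in> set (y # ys)")
    case False
    then have "y # ys \<in> paths x" using ys x by (auto simp: paths_def)
    from le[OF this] show ?thesis by (simp add: \<tau>y)
  next
    case True
    show ?thesis
    proof (cases "x = y")
      case True
      then show ?thesis using diag x by simp
    next
      case False
      then obtain as zs where as: "ys = as @ x # zs"
        using True by (auto dest: split_list)
      \<comment> \<open>Prepending \<open>x\<close> to the path would visit it twice. The path
        \<open>?cs\<close>, closed by the edge from \<open>x\<close> back to \<open>y\<close>, is a
        cycle; cutting it out leaves \<open>x # zs\<close> and adds no weight.\<close>
      let ?cs = "y # as @ [x]"
      have dis: "distinct ?cs" and sub: "set ?cs \<subseteq> X" and zs: "zs \<in> paths x"
        using ys by (auto simp: paths_def as)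
      have "0 \<le> (\<Sum>z\<in>X. w z (cycle_of_list ?cs z))"
        by (rule perm[OF permutes_subset[OF cycle_permutes sub]])
      also have "\<dots> = (\<Sum>z\<in>set ?cs. w z (cycle_of_list ?cs z))"
        using fin sub by (intro sum.mono_neutral_right) (auto simp: diag id_outside_supp)
      also have "\<dots> = path_weight w ?cs + w x y"
        using cycle_weight[OF dis, of w] by simp
      finally have "0 \<le> path_weight w ?cs + w x y" .
      moreover have "\<tau> y = path_weight w ?cs + path_weight w (x # zs)"
        using path_weight_append[of w "y # as" x zs] by (simp add: \<tau>y as)
      ultimately show ?thesis using le[OF zs] by simp
    qed
  qed
qed

text \<open>In a cheapest bijection, let \<open>w x y\<close> be the extra cost of moving the
  element matched with \<open>x\<close> to \<open>y\<close>. A permutation of \<open>X\<close>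
  yields another bijection, which is not cheaper; this is the hypothesis for a shortest path
  potential, and that potential is the dual solution.\<close>

lemma assignment_duality:
  fixes C :: "'b \<Rightarrow> 'x \<Rightarrow> real"
  assumes "finite B" "finite X" "card B = card X"
  obtains \<phi> \<tau> where "bij_betw \<phi> B X"
    "\<And>b y. b \<in> B \<Longrightarrow> y \<in> X \<Longrightarrow> C b (\<phi> b) + \<tau> (\<phi> b) \<le> C b y + \<tau> y"
proof -
  define \<Phi> where "\<Phi> = {\<phi> \<in> B \<rightarrow>\<^sub>E X. bij_betw \<phi> B X}"
  define cost where "cost \<phi> = (\<Sum>b\<in>B. C b (\<phi> b))" for \<phi>
  have "finite \<Phi>"
    unfolding \<Phi>_def using assms by (intro finite_subset[OF _ finite_PiE[of B "\<lambda>_. X"]]) auto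
  moreover obtain \<phi>0 where "bij_betw \<phi>0 B X"
    using finite_same_card_bij assms by blast
  then have "restrict \<phi>0 B \<in> \<Phi>"
    by (auto simp: \<Phi>_def bij_betw_apply)
  ultimately obtain \<phi> where \<phi>: "\<phi> \<in> \<Phi>" and opt: "\<And>\<psi>. \<psi> \<in> \<Phi> \<Longrightarrow> cost \<phi> \<le> cost \<psi>"
    using ex_is_arg_min_if_finite[of \<Phi> cost] by (auto simp: is_arg_min_linorder)
  have bij: "bij_betw \<phi> B X" using \<phi> by (simp add: \<Phi>_def)
  define w where "w x y = C (inv_into B \<phi> x) y - C (inv_into B \<phi> x) x" for x y
  have "0 \<le> (\<Sum>x\<in>X. w x (\<pi> x))" if "\<pi> permutes X" for \<pi>
  proof -
    have "bij_betw (\<pi> \<circ> \<phi>) B X"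
      using bij permutes_imp_bij[OF that] by (rule bij_betw_trans)
    then have "restrict (\<pi> \<circ> \<phi>) B \<in> \<Phi>"
      by (auto simp: \<Phi>_def dest: bij_betw_apply)
    from opt[OF this] have "0 \<le> (\<Sum>b\<in>B. C b (\<pi> (\<phi> b)) - C b (\<phi> b))"
      by (simp add: cost_def sum_subtractf)
    also have "\<dots> = (\<Sum>b\<in>B. w (\<phi> b) (\<pi> (\<phi> b)))"
      using bij by (intro sum.cong) (auto simp: w_def bij_betw_inv_into_left)
    also have "\<dots> = (\<Sum>x\<in>X. w x (\<pi> x))"
      using sum.reindex_bij_betw[OF bij, of "\<lambda>x. w x (\<pi> x)"] .
    finally show ?thesis .
  qed
  then obtain \<tau> where \<tau>: "\<And>x y. x \<in> X \<Longrightarrow> y \<in> X \<Longrightarrow> \<tau> x \<le> \<tau> y + w x y"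
    using shortest_path_potential[of X w] assms(2) by (auto simp: w_def)
  show thesis
  proof
    fix b y assume "b \<in> B" "y \<in> X"
    then show "C b (\<phi> b) + \<tau> (\<phi> b) \<le> C b y + \<tau> y"
      using \<tau>[of "\<phi> b" y] bij by (simp add: w_def bij_betw_apply bij_betw_inv_into_left)
  qed (fact bij)
qed

text \<open>Each red point is cancelled by one blue point that shares its side, so the \<open>n\<close> blue points
  are matched with \<open>n\<close> slots: the \<open>s\<close> sides and the red points.\<close>

lemma weighted_sides_assignment:
  fixes d :: "nat \<Rightarrow> 'a \<Rightarrow> real"
  assumes "finite B" "finite R" "B \<inter> R = {}" and card: "card B = s + card R"
    and pos: "\<And>i b. i < s \<Longrightarrow> b \<in> B \<Longrightarrow> 0 < d i b"
    and neg: "\<And>r. r \<in> R \<Longrightarrow> \<exists>i<s. d i r < 0"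
  obtains t :: "nat \<Rightarrow> real" and f where "\<forall>i. 0 < t i"
    "\<forall>x\<in>R \<union> B. f x < s \<and> (\<forall>j<s. t (f x) * d (f x) x \<le> t j * d j x)"
    "\<forall>i<s. card {b\<in>B. f b = i} = card {r\<in>R. f r = i} + 1"
proof -
  \<comment> \<open>The absolute value serves both colours: blue points have positive
    \<open>d j x\<close>, and red points are used only at sides where it is negative, so
    \<open>ln 0\<close> never matters.\<close>
  define h where "h j x = ln \<bar>d j x\<bar>" for j x
  define adm where "adm r = {j\<in>{..<s}. d j r < 0}" for r
  have fadm: "finite (adm r)" for r by (simp add: adm_def)
  define slot_cost where "slot_cost b y =
    (case y of Inl i \<Rightarrow> h i b | Inr r \<Rightarrow> Min ((\<lambda>j. h j b - h j r) ` adm r))" for b y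
  let ?X = "{..<s} <+> R"
  obtain \<phi> \<tau> where bij: "bij_betw \<phi> B ?X"
    and dual: "\<And>b y. b \<in> B \<Longrightarrow> y \<in> ?X \<Longrightarrow>
        slot_cost b (\<phi> b) + \<tau> (\<phi> b) \<le> slot_cost b y + \<tau> y"
    using assignment_duality[of B ?X slot_cost] assms by (auto simp: card_Plus)
  define \<psi> where "\<psi> = inv_into B \<phi>"
  have \<psi>: "\<psi> y \<in> B" "\<phi> (\<psi> y) = y" if "y \<in> ?X" for y
    using that bij unfolding \<psi>_def
    by (auto simp: bij_betw_inv_into_right bij_betw_def intro: inv_into_into)
  define t where "t i = exp (\<tau> (Inl i))" for i
  \<comment> \<open>The minimum that defines the cost for the blue partner of \<open>r\<close> is
    attained at some side. This side becomes \<open>g r\<close>, and both points are placed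
    there.\<close>
  have "\<exists>j\<in>adm r. \<forall>b. b = \<psi> (Inr r) \<longrightarrow> slot_cost b (Inr r) = h j b - h j r" if "r \<in> R" for r
  proof -
    have "adm r \<noteq> {}" using neg[OF that] by (auto simp: adm_def)
    then show ?thesis
      using Min_in[of "(\<lambda>j. h j (\<psi> (Inr r)) - h j r) ` adm r"] fadm[of r]
      by (simp add: slot_cost_def image_iff)
  qed
  then obtain g where g: "\<And>r. r \<in> R \<Longrightarrow> g r \<in> adm r"
    "\<And>r. r \<in> R \<Longrightarrow> slot_cost (\<psi> (Inr r)) (Inr r) = h (g r) (\<psi> (Inr r)) - h (g r) r"
    by metis
  define f where "f x = (if x \<in> R then g x else case \<phi> x of Inl i \<Rightarrow> i | Inr r \<Rightarrow> g r)" for x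
  have fR: "f r = g r" if "r \<in> R" for r using that by (simp add: f_def)
  have fB: "f b = (case \<phi> b of Inl i \<Rightarrow> i | Inr r \<Rightarrow> g r)" if "b \<in> B" for b
    using that assms(3) by (auto simp: f_def)
  \<comment> \<open>The blue point that holds side \<open>k\<close> gains nothing by moving to
    \<open>r\<close> through the same side; its own term \<open>h k\<close> cancels.\<close>
  have red_upper: "\<tau> (Inl k) + h k r \<le> \<tau> (Inr r)" if "r \<in> R" "k \<in> adm r" for r k
  proof -
    have k: "Inl k \<in> ?X" using that by (auto simp: adm_def)
    have "slot_cost (\<psi> (Inl k)) (Inr r) \<le> h k (\<psi> (Inl k)) - h k r"
      using that fadm by (auto simp: slot_cost_def)
    moreover have "slot_cost (\<psi> (Inl k)) (Inl k) = h k (\<psi> (Inl k))"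
      by (simp add: slot_cost_def)
    ultimately show ?thesis
      using dual[OF \<psi>(1)[OF k] InrI[OF \<open>r \<in> R\<close>]] \<psi>(2)[OF k] by simp
  qed
  \<comment> \<open>The blue partner of \<open>r\<close> gains nothing by moving to side
    \<open>k\<close>.\<close>
  have red_lower: "\<tau> (Inr r) + h (g r) b - h (g r) r \<le> \<tau> (Inl k) + h k b"
    if "r \<in> R" "k < s" "b = \<psi> (Inr r)" for r k b
  proof -
    have r: "Inr r \<in> ?X" using that by auto
    have "slot_cost b (Inl k) = h k b" by (simp add: slot_cost_def)
    then show ?thesis
      using dual[OF \<psi>(1)[OF r], of "Inl k"] \<psi>(2)[OF r] g(2)[OF \<open>r \<in> R\<close>] that(2,3)
      by (simp add: Plus_def)
  qed
  have gs: "g r < s" "d (g r) r < 0" if "r \<in> R" for r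
    using g(1)[OF that] by (auto simp: adm_def)
  \<comment> \<open>For \<open>k = g r\<close> the two bounds meet, so the potential of
    \<open>r\<close> is the largest value of \<open>\<tau> (Inl k) + h k r\<close> over the sides
    with \<open>d k r < 0\<close>.\<close>
  have tight: "\<tau> (Inr r) = \<tau> (Inl (g r)) + h (g r) r" if "r \<in> R" for r
    using red_upper[OF that g(1)[OF that]] red_lower[OF that gs(1)[OF that] refl] by simp
  have blue: "f b < s \<and> (\<forall>j<s. t (f b) * d (f b) b \<le> t j * d j b)" if "b \<in> B" for b
  proof -
    have "f b < s \<and> (\<forall>j<s. \<tau> (Inl (f b)) + h (f b) b \<le> \<tau> (Inl j) + h j b)"
    proof (cases "\<phi> b")
      case (Inl i)
      then have "i < s" using bij that by (auto dest: bij_betw_apply)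
      then show ?thesis
        using dual[OF that InlI] Inl by (fastforce simp: fB that slot_cost_def)
    next
      case (Inr r)
      then have r: "r \<in> R" using bij that by (auto dest: bij_betw_apply)
      have "b = \<psi> (Inr r)"
        using bij that by (simp add: \<psi>_def flip: Inr) (simp add: bij_betw_inv_into_left)
      then show ?thesis
        using red_lower[OF r _ \<open>b = \<psi> (Inr r)\<close>] tight[OF r] gs[OF r] fB[OF that] Inr
        by (force simp: algebra_simps)
    qed
    moreover have "t j * d j b = exp (\<tau> (Inl j) + h j b)" if "j < s" for j
      using pos[OF that \<open>b \<in> B\<close>] by (simp add: t_def h_def exp_add)
    ultimately show ?thesis by auto
  qed
  have red: "f r < s \<and> (\<forall>j<s. t (f r) * d (f r) r \<le> t j * d j r)" if "r \<in> R" for r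
  proof -
    \<comment> \<open>For negative values a larger logarithm means a smaller number, so the
      maximising side minimises \<open>t j * d j r\<close>. Sides with nonnegative
      \<open>d j r\<close> cannot be smaller.\<close>
    have eq: "t j * d j r = - exp (\<tau> (Inl j) + h j r)" if "d j r < 0" for j
      using that by (simp add: t_def h_def exp_add)
    have "t (g r) * d (g r) r \<le> t j * d j r" if "j < s" for j
    proof (cases "d j r < 0")
      case True
      then have "\<tau> (Inl j) + h j r \<le> \<tau> (Inl (g r)) + h (g r) r"
        using red_upper[OF \<open>r \<in> R\<close>, of j] tight[OF \<open>r \<in> R\<close>] \<open>j < s\<close> by (auto simp: adm_def)
      then show ?thesis using True gs(2)[OF \<open>r \<in> R\<close>] by (simp add: eq)
    next
      case False
      then have "0 \<le> t j * d j r" by (simp add: t_def)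
      moreover have "t (g r) * d (g r) r \<le> 0"
        using gs(2)[OF \<open>r \<in> R\<close>] by (simp add: eq)
      ultimately show ?thesis by simp
    qed
    then show ?thesis using gs(1) fR that by simp
  qed
  have count: "card {b\<in>B. f b = i} = card {r\<in>R. f r = i} + 1" if "i < s" for i
  proof -
    \<comment> \<open>The blue points of region \<open>i\<close> are the one in slot
      \<open>Inl i\<close>, which is the surplus of 1, and the partners of the red points of that
      region.\<close>
    have "bij_betw \<phi> {b\<in>B. f b = i} (insert (Inl i) (Inr ` {r\<in>R. f r = i}))"
      unfolding bij_betw_def
    proof
      show "inj_on \<phi> {b\<in>B. f b = i}"
        using bij by (auto simp: bij_betw_def intro: inj_on_subset)
      show "\<phi> ` {b\<in>B. f b = i} = insert (Inl i) (Inr ` {r\<in>R. f r = i})"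
      proof
        show "\<phi> ` {b\<in>B. f b = i} \<subseteq> insert (Inl i) (Inr ` {r\<in>R. f r = i})"
        proof clarify
          fix b assume b: "b \<in> B" "\<phi> b \<notin> Inr ` {r\<in>R. f r = f b}"
          show "\<phi> b = Inl (f b)"
          proof (cases "\<phi> b")
            case (Inr r)
            then have "r \<in> R" using bij b by (auto dest: bij_betw_apply)
            then show ?thesis using b Inr by (auto simp: fB fR)
          qed (simp add: fB b)
        qed
        have "y \<in> \<phi> ` {b\<in>B. f b = i}" if "y \<in> insert (Inl i) (Inr ` {r\<in>R. f r = i})" for y
        proof -
          have y: "y \<in> ?X" using that \<open>i < s\<close> by auto
          have "f (\<psi> y) = i" using that \<psi>[OF y] by (auto simp: fB fR)
          then show ?thesis using \<psi>[OF y] by (metis (mono_tags, lifting) image_iff mem_Collect_eq)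
        qed
        then show "insert (Inl i) (Inr ` {r\<in>R. f r = i}) \<subseteq> \<phi> ` {b\<in>B. f b = i}" by blast
      qed
    qed
    from bij_betw_same_card[OF this] show ?thesis
      using assms(2) by (subst (asm) card_insert_disjoint) (auto simp: card_image)
  qed
  show thesis
    by (rule that[of t f]) (use red blue count in \<open>auto simp: t_def\<close>)
qed

section \<open>Piecewise affine curves and polygonal chains\<close>

text \<open>One affine formula is required on every convex \<open>J\<close> whose interior avoids
  \<open>X\<close>, endpoints included. This builds continuity at the breakpoints into the
  definition.\<close>

definition affine_off :: "real set \<Rightarrow> (real \<Rightarrow> 'a::real_vector) \<Rightarrow> bool" where
  "affine_off X G \<longleftrightarrow>
     (\<forall>J. convex J \<longrightarrow> interior J \<inter> X = {} \<longrightarrow> (\<exists>c d. \<forall>t\<in>J. G t = c + t *\<^sub>R d))"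

definition piecewise_affine :: "(real \<Rightarrow> 'a::real_vector) \<Rightarrow> bool" where
  "piecewise_affine G \<longleftrightarrow> (\<exists>X. finite X \<and> affine_off X G)"

lemma affine_offD:
  "affine_off X G \<Longrightarrow> convex J \<Longrightarrow> interior J \<inter> X = {} \<Longrightarrow> \<exists>c d. \<forall>t\<in>J. G t = c + t *\<^sub>R d"
  by (simp add: affine_off_def)

lemma piecewise_affineI:
  assumes "finite X"
    "\<And>J. convex J \<Longrightarrow> interior J \<inter> X = {} \<Longrightarrow> \<exists>c d. \<forall>t\<in>J. G t = c + t *\<^sub>R d"
  shows "piecewise_affine G"
  unfolding piecewise_affine_def affine_off_def using assms by (intro exI[of _ X]) simp

lemma piecewise_affine_affine: "piecewise_affine (\<lambda>t. c + t *\<^sub>R d)"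
  by (rule piecewise_affineI[of "{}"]) auto

lemma piecewise_affine_curve:
  assumes "piecewise_affine g"
  shows "piecewise_affine (\<lambda>t. c + t *\<^sub>R d + g t *\<^sub>R v)"
proof -
  from assms obtain X where X: "finite X" "affine_off X g"
    unfolding piecewise_affine_def by blast
  have "\<exists>c' d'. \<forall>t\<in>J. c + t *\<^sub>R d + g t *\<^sub>R v = c' + t *\<^sub>R d'"
    if J: "convex J" "interior J \<inter> X = {}" for J
  proof -
    obtain b m where "\<forall>t\<in>J. g t = b + t *\<^sub>R m" using affine_offD[OF X(2) J] by blast
    then have "\<forall>t\<in>J. c + t *\<^sub>R d + g t *\<^sub>R v = (c + b *\<^sub>R v) + t *\<^sub>R (d + m *\<^sub>R v)"
      by (simp add: algebra_simps)
    then show ?thesis by blast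
  qed
  with X(1) show ?thesis by (rule piecewise_affineI)
qed

lemma piecewise_affine_reflect:
  assumes "piecewise_affine G"
  shows "piecewise_affine (\<lambda>t. G (a - t))"
proof -
  from assms obtain X where X: "finite X" "affine_off X G"
    unfolding piecewise_affine_def by blast
  have "\<exists>c' d'. \<forall>t\<in>J. G (a - t) = c' + t *\<^sub>R d'"
    if J: "convex J" "interior J \<inter> (-) a ` X = {}" for J
  proof -
    have "interior ((-) a ` J) = (-) a ` interior J"
      using interior_translation[of a "uminus ` J"] interior_negations[of J]
      by (simp add: image_image)
    then have "interior ((-) a ` J) \<inter> X = {}"
      using J(2) by (force simp: image_iff)
    moreover have "convex ((-) a ` J)"
      using convex_translation[of "uminus ` J" a] convex_negations[OF J(1)]
      by (simp add: image_image)
    ultimately obtain c d where "\<forall>t\<in>(-) a ` J. G t = c + t *\<^sub>R d" using affine_offD[OF X(2)] by blast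
    then have "\<forall>t\<in>J. G (a - t) = (c + a *\<^sub>R d) + t *\<^sub>R (- d)"
      by (simp add: algebra_simps)
    then show ?thesis by blast
  qed
  with finite_imageI[OF X(1)] show ?thesis by (rule piecewise_affineI)
qed

lemma interior_convex_real:
  fixes J :: "real set"
  assumes "convex J" "x \<in> J" "y \<in> J" "x < z" "z < y"
  shows "z \<in> interior J"
proof -
  have "is_interval J" using assms(1) by (simp only: is_interval_convex_1)
  then have "{x<..<y} \<subseteq> J"
    using mem_is_interval_1_I[OF _ assms(2,3)] by (simp add: subset_iff)
  then have "{x<..<y} \<subseteq> interior J" by (simp add: interior_maximal)
  then show ?thesis using assms by auto
qed

text \<open>Once \<open>b\<close> is a breakpoint, an admissible interval lies on one side of it;
  \<open>F b = G b\<close> settles the case of a right-hand interval that contains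
  \<open>b\<close>.\<close>

lemma piecewise_affine_if:
  assumes "piecewise_affine F" "piecewise_affine G" "F b = G b"
  shows "piecewise_affine (\<lambda>t. if t \<le> b then F t else G t)"
proof -
  obtain X where X: "finite X" "affine_off X F"
    using assms(1) unfolding piecewise_affine_def by blast
  obtain Y where Y: "finite Y" "affine_off Y G"
    using assms(2) unfolding piecewise_affine_def by blast
  have "\<exists>c d. \<forall>t\<in>J. (if t \<le> b then F t else G t) = c + t *\<^sub>R d"
    if J: "convex J" "interior J \<inter> insert b (X \<union> Y) = {}" for J
  proof -
    have "J \<subseteq> {..b} \<or> J \<subseteq> {b..}"
    proof (rule ccontr)
      assume "\<not> (J \<subseteq> {..b} \<or> J \<subseteq> {b..})"
      then obtain x y where "x \<in> J" "x < b" "y \<in> J" "b < y" by (auto simp: not_le subset_iff)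
      then have "b \<in> interior J" using interior_convex_real J(1) by blast
      then show False using J(2) by blast
    qed
    then show ?thesis
    proof
      assume "J \<subseteq> {..b}"
      moreover obtain c d where "\<forall>t\<in>J. F t = c + t *\<^sub>R d" using affine_offD[OF X(2), of J] J by blast
      ultimately show ?thesis by (intro exI[of _ c] exI[of _ d]) auto
    next
      assume sub: "J \<subseteq> {b..}"
      obtain c d where "\<forall>t\<in>J. G t = c + t *\<^sub>R d" using affine_offD[OF Y(2), of J] J by blast
      moreover have "(if t \<le> b then F t else G t) = G t" if "t \<in> J" for t
        using sub that assms(3) by (cases "t = b") auto
      ultimately show ?thesis by (intro exI[of _ c] exI[of _ d]) simp
    qed
  qed
  with X(1) Y(1) show ?thesis by (intro piecewise_affineI[of "insert b (X \<union> Y)"]) simp_all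
qed

text \<open>The affine function that is largest at an interior point of \<open>J\<close> stays
  largest on \<open>J\<close>: to be overtaken, it would have to meet another one at an interior
  point, and the meeting points are breakpoints.\<close>

lemma piecewise_affine_Max:
  fixes m b :: "'k \<Rightarrow> real"
  assumes "finite K" "K \<noteq> {}"
  shows "piecewise_affine (\<lambda>t. Max ((\<lambda>k. m k * t + b k) ` K))"
proof -
  let ?f = "\<lambda>k t. m k * t + b k"
  \<comment> \<open>For equal slopes the division by zero gives 0, an extra breakpoint that does no
    harm.\<close>
  define X where "X = (\<Union>(k, l)\<in>K \<times> K. {(b l - b k) / (m k - m l)})"
  have "finite X" using assms(1) by (simp add: X_def case_prod_beta)
  moreover have "\<exists>c d. \<forall>t\<in>J. Max ((\<lambda>k. ?f k t) ` K) = c + t *\<^sub>R d"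
    if J: "convex J" "interior J \<inter> X = {}" for J
  proof (cases "interior J = {}")
    case True
    have "\<exists>p. J \<subseteq> {p}"
    proof (cases "J = {}")
      case False
      then obtain p where p: "p \<in> J" by blast
      have "x = p" if "x \<in> J" for x
        using interior_convex_real[OF J(1) that p] interior_convex_real[OF J(1) p that]
          dense[of x p] dense[of p x] \<open>interior J = {}\<close> by (metis empty_iff linorder_neqE_linordered_idom)
      then show ?thesis by blast
    qed simp
    then obtain p where "J \<subseteq> {p}" by blast
    then show ?thesis
      by (intro exI[of _ "Max ((\<lambda>k. ?f k p) ` K)"] exI[of _ 0]) auto
  next
    case False
    then obtain s where s: "s \<in> interior J" by blast
    have "Max ((\<lambda>k. ?f k s) ` K) \<in> (\<lambda>k. ?f k s) ` K"
      using assms by (intro Max_in) auto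
    then obtain k where k: "k \<in> K" "Max ((\<lambda>k. ?f k s) ` K) = ?f k s" by blast
    have le: "?f l s \<le> ?f k s" if "l \<in> K" for l
      using assms(1) that by (simp flip: k(2))
    have "?f l t \<le> ?f k t" if l: "l \<in> K" and t: "t \<in> J" for l t
    proof (rule ccontr)
      assume gt: "\<not> ?f l t \<le> ?f k t"
      define z where "z = (b l - b k) / (m k - m l)"
      have ts: "t \<noteq> s" using gt le[OF l] by auto
      have ne: "m k \<noteq> m l" using gt le[OF l] by auto
      then have z: "(m k - m l) * z = b l - b k" by (simp add: z_def)
      have "(m k - m l) * (s - z) \<ge> 0" "(m k - m l) * (t - z) < 0"
        using gt le[OF l] z by (simp_all add: algebra_simps)
      then have "t < z \<and> z \<le> s \<or> s \<le> z \<and> z < t"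
        using ne by (auto simp: zero_le_mult_iff mult_less_0_iff)
      then have "z \<in> interior J"
        using interior_convex_real[OF J(1)] s t interior_subset[of J] by (metis le_less subsetD)
      moreover have "z \<in> X" using k(1) l by (auto simp: X_def z_def)
      ultimately show False using J(2) by blast
    qed
    then have "Max ((\<lambda>k. ?f k t) ` K) = ?f k t" if "t \<in> J" for t
      using assms k(1) that by (intro Max_eqI) auto
    then show ?thesis by (intro exI[of _ "b k"] exI[of _ "m k"]) auto
  qed
  ultimately show ?thesis by (rule piecewise_affineI)
qed

text \<open>The list \<open>xs\<close> cuts the line into the gaps with numbers \<open>0, \<dots>, length xs\<close>, the first and the
  last of them unbounded.\<close>

definition gap :: "real list \<Rightarrow> nat \<Rightarrow> real set" where
  "gap xs k = {t. (k < length xs \<longrightarrow> t \<le> xs ! k) \<and> (0 < k \<longrightarrow> xs ! (k - 1) \<le> t)}"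

definition open_gap :: "real list \<Rightarrow> nat \<Rightarrow> real set" where
  "open_gap xs k = {t. (k < length xs \<longrightarrow> t < xs ! k) \<and> (0 < k \<longrightarrow> xs ! (k - 1) < t)}"

context
  fixes xs :: "real list"
  assumes sorted: "sorted_wrt (<) xs" and nonempty: "xs \<noteq> []"
begin

lemma nth_less_iff: "i < length xs \<Longrightarrow> j < length xs \<Longrightarrow> xs ! i < xs ! j \<longleftrightarrow> i < j"
  using sorted by (metis linorder_neqE_nat order_less_asym order_less_irrefl sorted_wrt_nth_less)

lemma gap_cases:
  assumes "k \<le> length xs"
  obtains (first) "k = 0" "gap xs k = {..xs ! 0}" "open_gap xs k = {..<xs ! 0}"
  | (mid) "0 < k" "k < length xs" "gap xs k = {xs ! (k - 1)..xs ! k}"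
      "open_gap xs k = {xs ! (k - 1)<..<xs ! k}" "xs ! (k - 1) < xs ! k"
  | (last) "k = length xs" "0 < k" "gap xs k = {last xs..}" "open_gap xs k = {last xs<..}"
proof -
  consider "k = 0" | "0 < k" "k < length xs" | "k = length xs" "0 < k" using assms by linarith
  then show thesis
  proof cases
    case 1
    then show ?thesis using nonempty by (intro first) (auto simp: gap_def open_gap_def)
  next
    case 2
    then show ?thesis
      using nth_less_iff[of "k - 1" k] by (intro mid) (auto simp: gap_def open_gap_def)
  next
    case 3
    then show ?thesis
      using nonempty by (intro last) (auto simp: gap_def open_gap_def last_conv_nth)
  qed
qed

lemma gap_facts:
  assumes "k \<le> length xs"
  shows "convex (gap xs k)" "interior (gap xs k) = open_gap xs k" "open_gap xs k \<noteq> {}"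
    "open_gap xs k \<inter> set xs = {}"
proof -
  show "convex (gap xs k)" "interior (gap xs k) = open_gap xs k" "open_gap xs k \<noteq> {}"
    using assms by (cases k rule: gap_cases; simp)+
  show "open_gap xs k \<inter> set xs = {}"
  proof (rule ccontr)
    assume "open_gap xs k \<inter> set xs \<noteq> {}"
    then obtain l where l: "l < length xs" "xs ! l \<in> open_gap xs k" by (auto simp: in_set_conv_nth)
    then have "k < length xs \<longrightarrow> l < k" "0 < k \<longrightarrow> k - 1 < l"
      using assms nth_less_iff[of l k] nth_less_iff[of "k - 1" l] by (auto simp: open_gap_def)
    then show False using l(1) assms nonempty by (cases "k = 0") auto
  qed
qed

lemma open_gap_disjoint:
  assumes "i \<le> length xs" "j \<le> length xs" "i \<noteq> j"
  shows "open_gap xs i \<inter> open_gap xs j = {}"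
proof -
  have "open_gap xs i \<inter> open_gap xs j = {}" if "i < j" "j \<le> length xs" for i j
  proof -
    have "xs ! i \<le> xs ! (j - 1)"
      using that nth_less_iff[of "j - 1" i] by (intro leI) auto
    then show ?thesis using that by (auto simp: open_gap_def)
  qed
  from this[of i j] this[of j i] show ?thesis using assms by (metis Int_commute nat_neq_iff)
qed

end

section \<open>From parametrised curves to the pieces of a chain\<close>

lemma rel_interior_affine_image:
  fixes G :: "real \<Rightarrow> 'a::euclidean_space"
  assumes "convex I" "interior I \<noteq> {}" "d \<noteq> 0" "\<forall>t\<in>I. G t = c + t *\<^sub>R d"
  shows "rel_interior (G ` I) = G ` interior I"
proof -
  have lin: "bounded_linear (\<lambda>t. t *\<^sub>R d)" by (rule bounded_linear_scaleR_left)
  have inj: "inj (\<lambda>t. t *\<^sub>R d)" using assms(3) by (auto intro!: injI)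
  have "G ` I = (+) c ` (\<lambda>t. t *\<^sub>R d) ` I" using assms(4) by (auto simp: image_image)
  then have "rel_interior (G ` I) = (+) c ` rel_interior ((\<lambda>t. t *\<^sub>R d) ` I)"
    by (simp add: rel_interior_translation)
  also have "\<dots> = (+) c ` (\<lambda>t. t *\<^sub>R d) ` rel_interior I"
    using rel_interior_injective_linear_image[OF lin inj] by simp
  also have "\<dots> = (\<lambda>t. c + t *\<^sub>R d) ` interior I"
    using rel_interior_nonempty_interior[OF assms(2)] by (simp add: image_image)
  also have "\<dots> = G ` interior I"
    using assms(4) interior_subset[of I] by (intro image_cong) auto
  finally show ?thesis .
qed

text \<open>Injectivity on the union of the open gaps does two things: no piece degenerates to a
  point, and the relative interiors of different pieces are disjoint. Breakpoints are exempt, so a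
  curve may close up at its ends.\<close>

lemma curve_pieces:
  fixes G :: "real \<Rightarrow> real^2"
  assumes xs: "sorted_wrt (<) xs" "xs \<noteq> []"
    and ks: "distinct ks" "set ks \<subseteq> {..length xs}"
    and aff: "\<And>k. k \<in> set ks \<Longrightarrow> \<exists>c d. \<forall>t\<in>gap xs k. G t = c + t *\<^sub>R d"
    and inj: "inj_on G (\<Union>k\<in>set ks. open_gap xs k)"
  shows "non_crossing (map (\<lambda>k. G ` gap xs k) ks)"
    and "\<And>k. k \<in> set ks \<Longrightarrow> \<exists>c d. d \<noteq> 0 \<and> (\<forall>t\<in>gap xs k. G t = c + t *\<^sub>R d)"
proof -
  show aff': "\<exists>c d. d \<noteq> 0 \<and> (\<forall>t\<in>gap xs k. G t = c + t *\<^sub>R d)" if k: "k \<in> set ks" for k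
  proof -
    have kl: "k \<le> length xs" using ks(2) k by auto
    obtain c d where cd: "\<forall>t\<in>gap xs k. G t = c + t *\<^sub>R d" using aff[OF k] by blast
    have "infinite (open_gap xs k)"
      by (cases rule: gap_cases[OF xs kl]) (simp_all add: infinite_Ioo infinite_Iio infinite_Ioi)
    then obtain x where x: "x \<in> open_gap xs k" by (metis ex_in_conv finite.emptyI)
    have "infinite (open_gap xs k - {x})" using \<open>infinite (open_gap xs k)\<close> by simp
    then have "open_gap xs k - {x} \<noteq> {}" by (metis finite.emptyI)
    then obtain y where y: "y \<in> open_gap xs k" "y \<noteq> x" by blast
    have "G x \<noteq> G y" using inj_onD[OF inj, of x y] x y k by blast
    moreover have "open_gap xs k \<subseteq> gap xs k" by (auto simp: gap_def open_gap_def)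
    ultimately have "d \<noteq> 0" using cd x y(1) by (metis scaleR_zero_right subsetD)
    then show ?thesis using cd by blast
  qed
  have ri: "rel_interior (G ` gap xs k) = G ` open_gap xs k" if k: "k \<in> set ks" for k
    using aff'[OF k] rel_interior_affine_image[of "gap xs k" _ G] gap_facts[OF xs, of k] ks(2) k
    by auto
  show "non_crossing (map (\<lambda>k. G ` gap xs k) ks)"
    unfolding non_crossing_def
  proof (intro allI impI)
    fix i j
    assume ij: "i < length (map (\<lambda>k. G ` gap xs k) ks)" "j < length (map (\<lambda>k. G ` gap xs k) ks)"
      "i \<noteq> j"
    then have mem: "ks ! i \<in> set ks" "ks ! j \<in> set ks" and "ks ! i \<noteq> ks ! j"
      using ks(1) by (auto simp: nth_eq_iff_index_eq)
    then have "open_gap xs (ks ! i) \<inter> open_gap xs (ks ! j) = {}"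
      using open_gap_disjoint[OF xs] ks(2) by (meson atMost_iff subsetD)
    then have "G ` open_gap xs (ks ! i) \<inter> G ` open_gap xs (ks ! j) = {}"
      using inj mem by (subst inj_on_image_Int[symmetric, OF inj]) auto
    then show "rel_interior (map (\<lambda>k. G ` gap xs k) ks ! i) \<inter>
        rel_interior (map (\<lambda>k. G ` gap xs k) ks ! j) = {}"
      using ij mem by (simp add: ri)
  qed
qed

lemma affine_image_closed_segment:
  assumes "x \<le> y" "\<forall>t\<in>{x..y}. G t = c + t *\<^sub>R d"
  shows "G ` {x..y} = closed_segment (G x) (G y)"
proof -
  have "linear (\<lambda>t. t *\<^sub>R d)" by (intro linearI) (auto simp: algebra_simps)
  from closed_segment_linear_image[OF this, of x y]
  have "closed_segment (G x) (G y) = (+) c ` (\<lambda>t. t *\<^sub>R d) ` closed_segment x y"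
    using assms closed_segment_translation[of c "x *\<^sub>R d" "y *\<^sub>R d"] by simp
  then show ?thesis
    using assms by (auto simp: image_image closed_segment_eq_real_ivl)
qed

text \<open>The segment at list position \<open>i\<close> joins vertices \<open>i\<close> and
  \<open>Suc i\<close>, so it is the image of gap \<open>Suc i\<close>; gap 0 lies to the left of
  the first vertex.\<close>

lemma map2_closed_segment_gaps:
  assumes xs: "sorted_wrt (<) xs" "xs \<noteq> []"
    and aff: "\<And>k. 0 < k \<Longrightarrow> k < length xs \<Longrightarrow> \<exists>c d. \<forall>t\<in>gap xs k. G t = c + t *\<^sub>R d"
  shows "map2 closed_segment (butlast (map G xs)) (tl (map G xs)) =
    map (\<lambda>k. G ` gap xs k) [1..<length xs]"
proof (rule nth_equalityI)
  fix i assume "i < length (map2 closed_segment (butlast (map G xs)) (tl (map G xs)))"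
  then have i: "Suc i < length xs" by simp
  then have gap: "gap xs (Suc i) = {xs ! i..xs ! Suc i}" "xs ! i \<le> xs ! Suc i"
    using nth_less_iff[OF xs, of i "Suc i"] by (auto simp: gap_def)
  obtain c d where "\<forall>t\<in>gap xs (Suc i). G t = c + t *\<^sub>R d" using aff[of "Suc i"] i by auto
  then have "G ` gap xs (Suc i) = closed_segment (G (xs ! i)) (G (xs ! Suc i))"
    using gap affine_image_closed_segment[of "xs ! i" "xs ! Suc i" G c d] by simp
  then show "map2 closed_segment (butlast (map G xs)) (tl (map G xs)) ! i =
      map (\<lambda>k. G ` gap xs k) [1..<length xs] ! i"
    using i by (simp add: nth_butlast nth_tl)
qed simp

lemma successively_map_gaps:
  fixes G :: "real \<Rightarrow> 'a::real_vector"
  assumes xs: "sorted_wrt (<) xs" "xs \<noteq> []"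
    and aff: "\<And>k. 0 < k \<Longrightarrow> k < length xs \<Longrightarrow> \<exists>c d. d \<noteq> 0 \<and> (\<forall>t\<in>gap xs k. G t = c + t *\<^sub>R d)"
  shows "successively (\<noteq>) (map G xs)"
  unfolding successively_conv_nth
proof (intro allI impI)
  fix i assume "Suc i < length (map G xs)"
  then have i: "Suc i < length xs" by simp
  then have less: "xs ! i < xs ! Suc i"
    using nth_less_iff[OF xs, of i "Suc i"] by simp
  then have "xs ! i \<in> gap xs (Suc i)" "xs ! Suc i \<in> gap xs (Suc i)" by (simp_all add: gap_def)
  moreover obtain c d where "d \<noteq> 0" "\<forall>t\<in>gap xs (Suc i). G t = c + t *\<^sub>R d"
    using aff[of "Suc i"] i by auto
  ultimately show "map G xs ! i \<noteq> map G xs ! Suc i" using i less by auto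
qed

lemma sorted_list_of_nonempty_set:
  fixes X :: "'a::linorder set"
  assumes "finite X" "X \<noteq> {}"
  obtains xs where "sorted_wrt (<) xs" "xs \<noteq> []" "set xs = X"
  using assms by (intro that[of "sorted_list_of_set X"]) auto

lemma polygonal_chain_range:
  fixes G :: "real \<Rightarrow> real^2"
  assumes "piecewise_affine G" "inj G"
  shows "polygonal_chain (range G)"
proof -
  from assms(1) obtain X where X: "finite X" "affine_off X G"
    unfolding piecewise_affine_def by blast
  \<comment> \<open>The 0 makes the list nonempty, since a chain must have a vertex.\<close>
  obtain xs where xs: "sorted_wrt (<) xs" "xs \<noteq> []" "set xs = insert 0 X"
    using sorted_list_of_nonempty_set[of "insert 0 X"] X(1) by blast
  let ?n = "length xs"
  let ?ks = "[0..<Suc ?n]"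
  have n: "0 < ?n" using xs by simp
  have aff: "\<exists>c d. \<forall>t\<in>gap xs k. G t = c + t *\<^sub>R d" if "k \<le> ?n" for k
    using gap_facts[OF xs(1,2) that] xs(3) by (intro affine_offD[OF X(2)]) auto
  have nc: "non_crossing (map (\<lambda>k. G ` gap xs k) ?ks)"
    and aff': "\<And>k. k \<le> ?n \<Longrightarrow> \<exists>c d. d \<noteq> 0 \<and> (\<forall>t\<in>gap xs k. G t = c + t *\<^sub>R d)"
    using curve_pieces[OF xs(1,2), of ?ks G] aff inj_on_subset[OF assms(2) subset_UNIV]
    by (simp_all add: less_Suc_eq_le subset_iff del: upt_Suc)
  obtain c d where d: "d \<noteq> 0" "\<forall>t\<in>{..xs ! 0}. G t = c + t *\<^sub>R d"
    using aff'[of 0] n by (auto simp: gap_def)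
  \<comment> \<open>The half-line leaves the first vertex against the direction of the parameter,
    hence \<open>- d\<close>.\<close>
  have first: "G ` gap xs 0 = half_line (hd (map G xs)) (- d)"
  proof
    show "G ` gap xs 0 \<subseteq> half_line (hd (map G xs)) (- d)"
    proof
      fix x assume "x \<in> G ` gap xs 0"
      then obtain t where "t \<le> xs ! 0" "x = G t" using n by (auto simp: gap_def)
      then have "x = hd (map G xs) + (xs ! 0 - t) *\<^sub>R (- d)"
        using d xs(2) by (simp add: hd_map hd_conv_nth algebra_simps)
      then show "x \<in> half_line (hd (map G xs)) (- d)"
        using \<open>t \<le> xs ! 0\<close> unfolding half_line_def by force
    qed
    show "half_line (hd (map G xs)) (- d) \<subseteq> G ` gap xs 0"
    proof
      fix x assume "x \<in> half_line (hd (map G xs)) (- d)"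
      then obtain t where t: "x = hd (map G xs) + t *\<^sub>R (- d)" "0 \<le> t" by (auto simp: half_line_def)
      then have "x = G (xs ! 0 - t)"
        using d xs(2) by (simp add: hd_map hd_conv_nth algebra_simps)
      then show "x \<in> G ` gap xs 0" using t(2) by (auto simp: gap_def)
    qed
  qed
  obtain c' d' where d': "d' \<noteq> 0" "\<forall>t\<in>{last xs..}. G t = c' + t *\<^sub>R d'"
    using aff'[of ?n] n xs(2) by (auto simp: gap_def last_conv_nth)
  have gl: "gap xs ?n = {last xs..}" using n xs(2) by (auto simp: gap_def last_conv_nth)
  have last: "G ` gap xs ?n = half_line (last (map G xs)) d'"
  proof
    show "G ` gap xs ?n \<subseteq> half_line (last (map G xs)) d'"
    proof
      fix x assume "x \<in> G ` gap xs ?n"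
      then obtain t where "last xs \<le> t" "x = G t" using gl by auto
      then have "x = last (map G xs) + (t - last xs) *\<^sub>R d'"
        using d' xs(2) by (simp add: last_map algebra_simps)
      then show "x \<in> half_line (last (map G xs)) d'"
        using \<open>last xs \<le> t\<close> unfolding half_line_def by force
    qed
    show "half_line (last (map G xs)) d' \<subseteq> G ` gap xs ?n"
    proof
      fix x assume "x \<in> half_line (last (map G xs)) d'"
      then obtain t where t: "x = last (map G xs) + t *\<^sub>R d'" "0 \<le> t" by (auto simp: half_line_def)
      then have "x = G (last xs + t)"
        using d' xs(2) by (simp add: last_map algebra_simps)
      then show "x \<in> G ` gap xs ?n" using t(2) gl by auto
    qed
  qed
  have ks: "?ks = 0 # [1..<?n] @ [?n]"
    using n by (simp add: upt_conv_Cons)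
  have pieces: "chain_pieces (Some (- d)) (map G xs) (Some d') = map (\<lambda>k. G ` gap xs k) ?ks"
    unfolding chain_pieces_def ks using map2_closed_segment_gaps[OF xs(1,2), of G] aff
    by (simp add: first last)
  have "(\<Union>k\<in>set ?ks. gap xs k) = UNIV"
  proof (rule sym, rule UNIV_eq_I)
    fix t
    \<comment> \<open>The gap of \<open>t\<close> ends at the first breakpoint not below
      \<open>t\<close>; if there is none, the index is \<open>?n\<close>, that of the last
      gap.\<close>
    let ?k = "LEAST k. k < ?n \<longrightarrow> t \<le> xs ! k"
    have "?k < ?n \<longrightarrow> t \<le> xs ! ?k" by (rule LeastI[of _ ?n]) simp
    moreover have "?k \<le> ?n" by (rule Least_le) simp
    moreover have "xs ! (?k - 1) \<le> t" if "0 < ?k"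
      using not_less_Least[of "?k - 1" "\<lambda>k. k < ?n \<longrightarrow> t \<le> xs ! k"] that by auto
    ultimately have "t \<in> gap xs ?k" "?k \<in> set ?ks"
      unfolding gap_def by (auto simp del: upt_Suc)
    then show "t \<in> (\<Union>k\<in>set ?ks. gap xs k)" by blast
  qed
  then have "range G = \<Union> (set (chain_pieces (Some (- d)) (map G xs) (Some d')))"
    unfolding pieces by (simp only: set_map image_UN[symmetric])
  moreover have "successively (\<noteq>) (map G xs)"
    using aff' by (intro successively_map_gaps[OF xs(1,2)]) auto
  ultimately show ?thesis
    unfolding polygonal_chain_def using d(1) d'(1) nc xs(2)
    by (intro exI[of _ "Some (- d)"] exI[of _ "map G xs"] exI[of _ "Some d'"]) (simp add: pieces)
qed

text \<open>Injectivity is asked on the open interval, because for the boundary of a bounded region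
  both ends are mapped to the same point.\<close>

lemma polygonal_chain_closed:
  fixes G :: "real \<Rightarrow> real^2"
  assumes "piecewise_affine G" "\<alpha> < \<beta>" "inj_on G {\<alpha><..<\<beta>}"
  shows "polygonal_chain (G ` {\<alpha>..\<beta>})"
proof -
  from assms(1) obtain X where X: "finite X" "affine_off X G"
    unfolding piecewise_affine_def by blast
  \<comment> \<open>With both ends among the breakpoints, the gaps from 1 to \<open>?n - 1\<close>
    fill the interval exactly, and the two unbounded gaps are dropped.\<close>
  define Y where "Y = X \<inter> {\<alpha>..\<beta>} \<union> {\<alpha>, \<beta>}"
  have Y: "finite Y" "Y \<noteq> {}"
    using X(1) by (simp_all add: Y_def)
  obtain xs where xs: "sorted_wrt (<) xs" "xs \<noteq> []" "set xs = Y"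
    using sorted_list_of_nonempty_set[OF Y] by blast
  let ?n = "length xs"
  let ?ks = "[1..<?n]"
  have range: "\<alpha> \<le> xs ! k" "xs ! k \<le> \<beta>" if "k < ?n" for k
    using nth_mem[OF that] assms(2) by (auto simp: xs(3) Y_def)
  obtain i j where ij: "i < ?n" "xs ! i = \<alpha>" "j < ?n" "xs ! j = \<beta>"
    using xs(3) by (metis in_set_conv_nth insertI1 insertI2 Un_iff Y_def)
  have "i = 0" using nth_less_iff[OF xs(1,2), of 0 i] range(1)[of 0] ij xs(2) by force
  have "j = ?n - 1" using nth_less_iff[OF xs(1,2), of j "?n - 1"] range(2)[of "?n - 1"] ij by force
  have ends: "xs ! 0 = \<alpha>" "xs ! (?n - 1) = \<beta>" using ij \<open>i = 0\<close> \<open>j = ?n - 1\<close> by auto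
  have sub: "open_gap xs k \<subseteq> {\<alpha><..<\<beta>}" "gap xs k \<subseteq> {\<alpha>..\<beta>}" if "0 < k" "k < ?n" for k
    using that range(2)[OF that(2)] range(1)[OF less_imp_diff_less[OF that(2), of 1]]
    by (auto simp: open_gap_def gap_def)
  have aff: "\<exists>c d. \<forall>t\<in>gap xs k. G t = c + t *\<^sub>R d" if "0 < k" "k < ?n" for k
  proof (rule affine_offD[OF X(2)])
    have k: "k \<le> ?n" using that(2) by simp
    show "convex (gap xs k)" by (rule gap_facts(1)[OF xs(1,2) k])
    have "{\<alpha><..<\<beta>} \<inter> X \<subseteq> set xs" by (auto simp: xs(3) Y_def)
    then show "interior (gap xs k) \<inter> X = {}"
      using gap_facts(2,4)[OF xs(1,2) k] sub(1)[OF that] by blast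
  qed
  have "inj_on G (\<Union>k\<in>set ?ks. open_gap xs k)"
    using sub(1) by (intro inj_on_subset[OF assms(3)] UN_least) simp
  then have nc: "non_crossing (map (\<lambda>k. G ` gap xs k) ?ks)"
    and aff': "\<And>k. 0 < k \<Longrightarrow> k < ?n \<Longrightarrow> \<exists>c d. d \<noteq> 0 \<and> (\<forall>t\<in>gap xs k. G t = c + t *\<^sub>R d)"
    using curve_pieces[OF xs(1,2), of ?ks G] aff by (simp_all add: subset_iff Suc_le_eq)
  have pieces: "chain_pieces None (map G xs) None = map (\<lambda>k. G ` gap xs k) ?ks"
    unfolding chain_pieces_def using map2_closed_segment_gaps[OF xs(1,2), of G] aff by simp
  have "(\<Union>k\<in>set ?ks. gap xs k) = {\<alpha>..\<beta>}"
  proof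
    show "(\<Union>k\<in>set ?ks. gap xs k) \<subseteq> {\<alpha>..\<beta>}" using sub(2) by (intro UN_least) simp
    show "{\<alpha>..\<beta>} \<subseteq> (\<Union>k\<in>set ?ks. gap xs k)"
    proof
      fix t assume t: "t \<in> {\<alpha>..\<beta>}"
      have n2: "1 < ?n" using ends assms(2) xs(2) by (cases "?n = 1") (auto simp: neq_Nil_conv)
      let ?P = "\<lambda>k. 0 < k \<and> t \<le> xs ! k"
      let ?k = "LEAST k. ?P k"
      have P: "?P (?n - 1)" using n2 t ends by simp
      have k: "?P ?k" using P by (rule LeastI)
      have "?k \<le> ?n - 1" using P by (rule Least_le)
      moreover have "xs ! (?k - 1) \<le> t"
        using not_less_Least[of "?k - 1" ?P] k t ends by (cases "?k = 1") auto
      ultimately have "t \<in> gap xs ?k" "?k \<in> set ?ks" using k n2 by (auto simp: gap_def)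
      then show "t \<in> (\<Union>k\<in>set ?ks. gap xs k)" by blast
    qed
  qed
  then have "G ` {\<alpha>..\<beta>} = \<Union> (set (chain_pieces None (map G xs) None))"
    unfolding pieces by (simp only: set_map image_UN[symmetric])
  moreover have "successively (\<noteq>) (map G xs)"
    using aff' by (intro successively_map_gaps[OF xs(1,2)]) auto
  ultimately show ?thesis
    unfolding polygonal_chain_def using nc xs(2)
    by (intro exI[of _ None] exI[of _ "map G xs"]) (simp add: pieces)
qed

section \<open>Frontiers of intersections of half-planes\<close>

lemma interior_halfspaces:
  fixes n :: "'k \<Rightarrow> 'a::euclidean_space"
  assumes "finite K" "\<And>k. k \<in> K \<Longrightarrow> n k \<noteq> 0"
  shows "interior {x. \<forall>k\<in>K. n k \<bullet> x \<le> c k} = {x. \<forall>k\<in>K. n k \<bullet> x < c k}"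
  using assms
proof (induction K rule: finite_induct)
  case (insert k K)
  have "{x. \<forall>j\<in>insert k K. n j \<bullet> x \<le> c j} = {x. n k \<bullet> x \<le> c k} \<inter> {x. \<forall>j\<in>K. n j \<bullet> x \<le> c j}"
    by auto
  then show ?case using insert by auto
qed simp

lemma closed_halfspaces: "closed {x. \<forall>k\<in>K. n k \<bullet> x \<le> c k}"
proof -
  have "{x. \<forall>k\<in>K. n k \<bullet> x \<le> c k} = (\<Inter>k\<in>K. {x. n k \<bullet> x \<le> c k})" by auto
  then show ?thesis by (simp add: closed_INT closed_halfspace_le)
qed

lemma convex_halfspaces: "convex {x. \<forall>k\<in>K. n k \<bullet> x \<le> c k}"
proof -
  have "{x. \<forall>k\<in>K. n k \<bullet> x \<le> c k} = (\<Inter>k\<in>K. {x. n k \<bullet> x \<le> c k})" by auto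
  then show ?thesis by (simp add: convex_INT convex_halfspace_le)
qed

lemma frontier_halfspaces:
  fixes n :: "'k \<Rightarrow> 'a::euclidean_space"
  assumes "finite K" "\<And>k. k \<in> K \<Longrightarrow> n k \<noteq> 0"
  shows "frontier {x. \<forall>k\<in>K. n k \<bullet> x \<le> c k} =
    {x. (\<forall>k\<in>K. n k \<bullet> x \<le> c k) \<and> (\<exists>k\<in>K. n k \<bullet> x = c k)}"
proof -
  have "frontier {x. \<forall>k\<in>K. n k \<bullet> x \<le> c k} =
      {x. \<forall>k\<in>K. n k \<bullet> x \<le> c k} - {x. \<forall>k\<in>K. n k \<bullet> x < c k}"
    using interior_halfspaces[OF assms] by (simp add: frontier_def closure_closed closed_halfspaces)
  also have "\<dots> = {x. (\<forall>k\<in>K. n k \<bullet> x \<le> c k) \<and> (\<exists>k\<in>K. n k \<bullet> x = c k)}"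
    by (auto simp: less_le)
  finally show ?thesis .
qed

section \<open>Coordinates in which a chosen direction is vertical\<close>

definition perp :: "real^2 \<Rightarrow> real^2" where
  "perp v = vector [v $ 2, - v $ 1]"

lemma inner_perp: "perp v \<bullet> perp v = v \<bullet> v" "perp v \<bullet> v = 0" "v \<bullet> perp v = 0"
  by (simp_all add: perp_def inner_vec_def sum_2)

text \<open>Coordinates in the orthogonal basis \<open>perp v\<close>, \<open>v\<close>:
  \<open>a\<close> is the abscissa and \<open>y\<close> the height in the vertical direction
  \<open>v\<close>. The basis is not normalised.\<close>

definition pt :: "real^2 \<Rightarrow> real \<Rightarrow> real \<Rightarrow> real^2" where
  "pt v a y = a *\<^sub>R perp v + y *\<^sub>R v"

lemma inner_pt: "n \<bullet> pt v a y = a * (n \<bullet> perp v) + y * (n \<bullet> v)"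
  by (simp add: pt_def inner_add_right)

lemma pt_eq_iff:
  assumes "v \<noteq> 0"
  shows "pt v a y = pt v a' y' \<longleftrightarrow> a = a' \<and> y = y'"
proof
  assume eq: "pt v a y = pt v a' y'"
  from arg_cong[OF eq, of "(\<bullet>) (perp v)"] arg_cong[OF eq, of "(\<bullet>) v"] assms
  show "a = a' \<and> y = y'" by (simp add: inner_pt inner_perp)
qed simp

lemma pt_surj:
  assumes "v \<noteq> 0"
  obtains a y where "x = pt v a y"
proof
  have "(x \<bullet> perp v) *\<^sub>R perp v + (x \<bullet> v) *\<^sub>R v = (v \<bullet> v) *\<^sub>R x"
    by (simp add: perp_def vec_eq_iff forall_2 inner_vec_def sum_2 algebra_simps)
  then have "x = inverse (v \<bullet> v) *\<^sub>R ((x \<bullet> perp v) *\<^sub>R perp v + (x \<bullet> v) *\<^sub>R v)"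
    using assms by simp
  then show "x = pt v ((x \<bullet> perp v) / (v \<bullet> v)) ((x \<bullet> v) / (v \<bullet> v))"
    by (simp add: pt_def scaleR_add_right divide_inverse mult.commute)
qed

lemma nonzero_inner_perp:
  assumes "v \<noteq> 0" "n \<noteq> 0" "n \<bullet> v = 0"
  shows "n \<bullet> perp v \<noteq> 0"
proof
  assume "n \<bullet> perp v = 0"
  obtain a y where "n = pt v a y" using pt_surj assms(1) by blast
  then have "n \<bullet> n = 0" using assms(3) \<open>n \<bullet> perp v = 0\<close> by (metis add_0 inner_pt mult_zero_right)
  then show False using assms(2) by simp
qed

text \<open>For nonzero \<open>n \<bullet> v\<close>, the line \<open>n \<bullet> x = c\<close> is
  the graph of \<open>y = slope v n * a + c / (n \<bullet> v)\<close> in the coordinates of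
  \<open>pt\<close>.\<close>

definition slope :: "real^2 \<Rightarrow> real^2 \<Rightarrow> real" where
  "slope v n = - (n \<bullet> perp v) / (n \<bullet> v)"

lemma inner_pt_slope:
  "n \<bullet> v \<noteq> 0 \<Longrightarrow> n \<bullet> pt v a y = (y - slope v n * a) * (n \<bullet> v)"
  by (simp add: inner_pt slope_def field_simps)

lemma halfspace_lower:
  assumes "n \<bullet> v < 0"
  shows "n \<bullet> pt v a y \<le> c \<longleftrightarrow> slope v n * a + c / (n \<bullet> v) \<le> y"
    and "n \<bullet> pt v a y < c \<longleftrightarrow> slope v n * a + c / (n \<bullet> v) < y"
  using assms by (auto simp: inner_pt_slope field_simps)

lemma halfspace_upper:
  assumes "0 < n \<bullet> v"
  shows "n \<bullet> pt v a y \<le> c \<longleftrightarrow> y \<le> slope v n * a + c / (n \<bullet> v)"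
    and "n \<bullet> pt v a y < c \<longleftrightarrow> y < slope v n * a + c / (n \<bullet> v)"
  using assms by (auto simp: inner_pt_slope field_simps)

section \<open>The three shapes of a boundary\<close>

lemma polygonal_chain_graph:
  fixes n :: "'k \<Rightarrow> real^2"
  assumes K: "finite K" "K \<noteq> {}" and neg: "\<And>k. k \<in> K \<Longrightarrow> n k \<bullet> v < 0"
  shows "polygonal_chain (frontier {x. \<forall>k\<in>K. n k \<bullet> x \<le> c k})"
proof -
  have v: "v \<noteq> 0" using K(2) neg by force
  have nz: "n k \<noteq> 0" if "k \<in> K" for k using neg[OF that] by auto
  let ?f = "\<lambda>a k. slope v (n k) * a + c k / (n k \<bullet> v)"
  define g where "g a = Max (?f a ` K)" for a
  define G where "G t = pt v t (g t)" for t
  have "piecewise_affine g" unfolding g_def using K by (rule piecewise_affine_Max)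
  then have "piecewise_affine (\<lambda>t. 0 + t *\<^sub>R perp v + g t *\<^sub>R v)" by (rule piecewise_affine_curve)
  then have "piecewise_affine G" by (simp add: G_def[abs_def] pt_def)
  moreover have "inj G" using v by (auto intro!: injI simp: G_def pt_eq_iff)
  ultimately have "polygonal_chain (range G)" by (rule polygonal_chain_range)
  moreover have "frontier {x. \<forall>k\<in>K. n k \<bullet> x \<le> c k} = range G"
  proof (rule set_eqI)
    fix x
    obtain a y where x: "x = pt v a y" using pt_surj v by blast
    have "x \<in> frontier {x. \<forall>k\<in>K. n k \<bullet> x \<le> c k} \<longleftrightarrow>
        (\<forall>k\<in>K. n k \<bullet> pt v a y \<le> c k) \<and> \<not> (\<forall>k\<in>K. n k \<bullet> pt v a y < c k)"
      by (auto simp: frontier_halfspaces[OF K(1) nz] x less_le)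
    also have "\<dots> \<longleftrightarrow> g a \<le> y \<and> \<not> g a < y"
      unfolding g_def using K neg by (simp add: halfspace_lower cong: ball_cong)
    also have "\<dots> \<longleftrightarrow> y = g a" by auto
    also have "\<dots> \<longleftrightarrow> x \<in> range G"
      using v by (auto simp: x G_def pt_eq_iff)
    finally show "x \<in> frontier {x. \<forall>k\<in>K. n k \<bullet> x \<le> c k} \<longleftrightarrow> x \<in> range G" .
  qed
  ultimately show ?thesis by simp
qed

text \<open>Positive slopes bound \<open>a\<close> from below and negative slopes from above. The
  strictly feasible \<open>t\<close> makes the interval nondegenerate and the constraints of slope 0
  strict, so the weak and the strict system have the same endpoints.\<close>

lemma affine_nonneg_interval:
  fixes m b :: "'k \<Rightarrow> real"
  assumes K: "finite K" and pos: "\<And>k. k \<in> K \<Longrightarrow> 0 < m k * t + b k"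
    and "\<exists>k\<in>K. 0 < m k" "\<exists>k\<in>K. m k < 0"
  obtains \<alpha> \<beta> where "\<alpha> < \<beta>"
    "\<And>a. (\<forall>k\<in>K. 0 \<le> m k * a + b k) \<longleftrightarrow> \<alpha> \<le> a \<and> a \<le> \<beta>"
    "\<And>a. (\<forall>k\<in>K. 0 < m k * a + b k) \<longleftrightarrow> \<alpha> < a \<and> a < \<beta>"
proof -
  let ?P = "{k\<in>K. 0 < m k}" and ?N = "{k\<in>K. m k < 0}"
  let ?r = "\<lambda>k. - b k / m k"
  define \<alpha> where "\<alpha> = Max (?r ` ?P)"
  define \<beta> where "\<beta> = Min (?r ` ?N)"
  have P: "finite (?r ` ?P)" "?r ` ?P \<noteq> {}" and N: "finite (?r ` ?N)" "?r ` ?N \<noteq> {}"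
    using assms by auto
  have le: "\<alpha> \<le> a \<longleftrightarrow> (\<forall>k\<in>?P. 0 \<le> m k * a + b k)" "\<alpha> < a \<longleftrightarrow> (\<forall>k\<in>?P. 0 < m k * a + b k)"
    for a
    unfolding \<alpha>_def using P by (auto simp: field_simps)
  have ge: "a \<le> \<beta> \<longleftrightarrow> (\<forall>k\<in>?N. 0 \<le> m k * a + b k)" "a < \<beta> \<longleftrightarrow> (\<forall>k\<in>?N. 0 < m k * a + b k)"
    for a
    unfolding \<beta>_def using N by (auto simp: field_simps)
  have zero: "0 < b k" if "k \<in> K" "m k = 0" for k using pos[OF that(1)] that(2) by simp
  have split: "(\<forall>k\<in>K. Q k) \<longleftrightarrow> (\<forall>k\<in>?P. Q k) \<and> (\<forall>k\<in>?N. Q k)"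
    if "\<And>k. k \<in> K \<Longrightarrow> m k = 0 \<Longrightarrow> Q k" for Q
    using that by (metis (mono_tags, lifting) linorder_neqE_linordered_idom mem_Collect_eq)
  show thesis
  proof
    have "\<alpha> < t" "t < \<beta>" using pos by (simp_all add: le ge)
    then show "\<alpha> < \<beta>" by simp
    show "(\<forall>k\<in>K. 0 \<le> m k * a + b k) \<longleftrightarrow> \<alpha> \<le> a \<and> a \<le> \<beta>" for a
      unfolding le ge by (rule split) (use zero in \<open>simp add: less_imp_le\<close>)
    show "(\<forall>k\<in>K. 0 < m k * a + b k) \<longleftrightarrow> \<alpha> < a \<and> a < \<beta>" for a
      unfolding le ge by (rule split) (use zero in simp)
  qed
qed

text \<open>Half-planes with \<open>n k \<bullet> v = 0\<close> have vertical boundaries and confine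
  the abscissa to an interval; the others bound the height from below. The frontier is a graph
  between two vertical walls.\<close>

lemma polygonal_chain_half_strip:
  fixes n :: "'k \<Rightarrow> real^2"
  assumes K: "finite K" and nz: "\<And>k. k \<in> K \<Longrightarrow> n k \<noteq> 0"
    and x0: "\<And>k. k \<in> K \<Longrightarrow> n k \<bullet> x0 < c k"
    and le: "\<And>k. k \<in> K \<Longrightarrow> n k \<bullet> v \<le> 0" and ex: "\<exists>k\<in>K. n k \<bullet> v < 0"
    and left: "\<exists>k\<in>K. n k \<bullet> v = 0 \<and> n k \<bullet> perp v < 0"
    and right: "\<exists>k\<in>K. n k \<bullet> v = 0 \<and> 0 < n k \<bullet> perp v"
  shows "polygonal_chain (frontier {x. \<forall>k\<in>K. n k \<bullet> x \<le> c k})"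
proof -
  have v: "v \<noteq> 0" using ex by force
  define K0 where "K0 = {k\<in>K. n k \<bullet> v = 0}"
  define K1 where "K1 = {k\<in>K. n k \<bullet> v < 0}"
  have K01: "K = K0 \<union> K1" using le by (auto simp: K0_def K1_def less_le)
  have K1: "finite K1" "K1 \<noteq> {}" using K ex by (auto simp: K1_def)
  obtain a0 y0 where "x0 = pt v a0 y0" using pt_surj v by blast
  then have a0: "0 < - (n k \<bullet> perp v) * a0 + c k" if "k \<in> K0" for k
    using x0[of k] that by (simp add: K0_def inner_pt mult.commute)
  obtain \<alpha> \<beta> where ab: "\<alpha> < \<beta>"
    "\<And>a. (\<forall>k\<in>K0. 0 \<le> - (n k \<bullet> perp v) * a + c k) \<longleftrightarrow> \<alpha> \<le> a \<and> a \<le> \<beta>"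
    "\<And>a. (\<forall>k\<in>K0. 0 < - (n k \<bullet> perp v) * a + c k) \<longleftrightarrow> \<alpha> < a \<and> a < \<beta>"
  proof (rule affine_nonneg_interval[of K0 "\<lambda>k. - (n k \<bullet> perp v)" a0 c])
    show "finite K0" using K by (simp add: K0_def)
    show "\<exists>k\<in>K0. 0 < - (n k \<bullet> perp v)" "\<exists>k\<in>K0. - (n k \<bullet> perp v) < 0"
      using left right by (auto simp: K0_def)
  qed (use a0 in auto)
  have K0_le: "(\<forall>k\<in>K0. n k \<bullet> pt v a y \<le> c k) \<longleftrightarrow> \<alpha> \<le> a \<and> a \<le> \<beta>" for a y
    by (simp flip: ab(2)) (simp add: K0_def inner_pt mult.commute)
  have K0_less: "(\<forall>k\<in>K0. n k \<bullet> pt v a y < c k) \<longleftrightarrow> \<alpha> < a \<and> a < \<beta>" for a y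
    by (simp flip: ab(3)) (simp add: K0_def inner_pt mult.commute)
  let ?f = "\<lambda>a k. slope v (n k) * a + c k / (n k \<bullet> v)"
  define g where "g a = Max (?f a ` K1)" for a
  have K1_le: "(\<forall>k\<in>K1. n k \<bullet> pt v a y \<le> c k) \<longleftrightarrow> g a \<le> y" for a y
    unfolding g_def using K1 by (simp add: K1_def halfspace_lower cong: ball_cong)
  have K1_less: "(\<forall>k\<in>K1. n k \<bullet> pt v a y < c k) \<longleftrightarrow> g a < y" for a y
    unfolding g_def using K1 by (simp add: K1_def halfspace_lower cong: ball_cong)
  \<comment> \<open>\<open>A t\<close> is the point of the interval nearest to \<open>t\<close>, and
    the distance between them becomes extra height. One parameter thus descends the left wall,
    follows the graph and climbs the right wall.\<close>
  define A where "A t = (if t \<le> \<beta> then if t \<le> \<alpha> then \<alpha> else t else \<beta>)" for t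
  define Y where "Y t = g (A t) + \<bar>t - A t\<bar>" for t
  define G where "G t = pt v (A t) (Y t)" for t
  have pg: "piecewise_affine g" unfolding g_def using K1 by (rule piecewise_affine_Max)
  have "piecewise_affine (\<lambda>t. 0 + t *\<^sub>R perp v + g t *\<^sub>R v)" using pg by (rule piecewise_affine_curve)
  then have mid: "piecewise_affine (\<lambda>t. pt v t (g t))" by (simp add: pt_def)
  have "piecewise_affine (\<lambda>t. pt v \<alpha> (g \<alpha> + \<alpha>) + t *\<^sub>R (- v))"
    "piecewise_affine (\<lambda>t. pt v \<beta> (g \<beta> - \<beta>) + t *\<^sub>R v)"
    by (rule piecewise_affine_affine)+
  then have ends: "piecewise_affine (\<lambda>t. pt v \<alpha> (g \<alpha> + \<alpha> - t))"
    "piecewise_affine (\<lambda>t. pt v \<beta> (g \<beta> - \<beta> + t))"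
    by (simp_all add: pt_def algebra_simps)
  have "piecewise_affine (\<lambda>t. if t \<le> \<beta> then if t \<le> \<alpha> then pt v \<alpha> (g \<alpha> + \<alpha> - t) else pt v t (g t)
      else pt v \<beta> (g \<beta> - \<beta> + t))"
    using ab(1) by (intro piecewise_affine_if ends mid) auto
  also have "(\<lambda>t. if t \<le> \<beta> then if t \<le> \<alpha> then pt v \<alpha> (g \<alpha> + \<alpha> - t) else pt v t (g t)
      else pt v \<beta> (g \<beta> - \<beta> + t)) = G"
    by (auto simp: G_def A_def Y_def fun_eq_iff algebra_simps)
  finally have "piecewise_affine G" .
  moreover have "inj G"
    using v ab(1) by (auto intro!: injI simp: G_def pt_eq_iff A_def Y_def split: if_splits)
  ultimately have "polygonal_chain (range G)" by (rule polygonal_chain_range)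
  moreover have "frontier {x. \<forall>k\<in>K. n k \<bullet> x \<le> c k} = range G"
  proof (rule set_eqI)
    fix x
    obtain a y where x: "x = pt v a y" using pt_surj v by blast
    have "x \<in> frontier {x. \<forall>k\<in>K. n k \<bullet> x \<le> c k} \<longleftrightarrow>
        (\<forall>k\<in>K. n k \<bullet> pt v a y \<le> c k) \<and> \<not> (\<forall>k\<in>K. n k \<bullet> pt v a y < c k)"
      by (auto simp: frontier_halfspaces[OF K nz] x less_le)
    also have "\<dots> \<longleftrightarrow> (\<alpha> \<le> a \<and> a \<le> \<beta> \<and> g a \<le> y) \<and> \<not> (\<alpha> < a \<and> a < \<beta> \<and> g a < y)"
      unfolding K01 ball_Un K0_le K0_less K1_le K1_less by blast
    also have "\<dots> \<longleftrightarrow> (\<exists>t. a = A t \<and> y = Y t)"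
    proof
      assume R: "(\<alpha> \<le> a \<and> a \<le> \<beta> \<and> g a \<le> y) \<and> \<not> (\<alpha> < a \<and> a < \<beta> \<and> g a < y)"
      then consider "a = \<alpha>" "g a \<le> y" | "a = \<beta>" "g a \<le> y" | "\<alpha> \<le> a" "a \<le> \<beta>" "y = g a" by linarith
      then show "\<exists>t. a = A t \<and> y = Y t"
      proof cases
        case 1
        then show ?thesis using ab(1) by (intro exI[of _ "\<alpha> - (y - g \<alpha>)"]) (simp add: A_def Y_def)
      next
        case 2
        then show ?thesis using ab(1) by (intro exI[of _ "\<beta> + (y - g \<beta>)"]) (auto simp: A_def Y_def)
      next
        case 3
        then show ?thesis by (intro exI[of _ a]) (auto simp: A_def Y_def)
      qed
    next
      assume "\<exists>t. a = A t \<and> y = Y t"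
      then show "(\<alpha> \<le> a \<and> a \<le> \<beta> \<and> g a \<le> y) \<and> \<not> (\<alpha> < a \<and> a < \<beta> \<and> g a < y)"
        using ab(1) by (auto simp: A_def Y_def split: if_splits)
    qed
    also have "\<dots> \<longleftrightarrow> x \<in> range G"
      using v by (auto simp: x G_def pt_eq_iff)
    finally show "x \<in> frontier {x. \<forall>k\<in>K. n k \<bullet> x \<le> c k} \<longleftrightarrow> x \<in> range G" .
  qed
  ultimately show ?thesis by simp
qed

text \<open>No boundary line is vertical, so the region lies between a lower graph, a maximum, and
  an upper graph, a minimum. Without recession directions the graphs must meet on both
  sides.\<close>

lemma polygonal_chain_bounded:
  fixes n :: "'k \<Rightarrow> real^2"
  assumes K: "finite K" and x0: "\<And>k. k \<in> K \<Longrightarrow> n k \<bullet> x0 < c k"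
    and v: "v \<noteq> 0" and generic: "\<And>k. k \<in> K \<Longrightarrow> n k \<bullet> v \<noteq> 0"
    and no_recession: "\<And>w. w \<noteq> 0 \<Longrightarrow> \<exists>k\<in>K. 0 < n k \<bullet> w"
  shows "polygonal_chain (frontier {x. \<forall>k\<in>K. n k \<bullet> x \<le> c k})"
proof -
  have nz: "n k \<noteq> 0" if "k \<in> K" for k using generic[OF that] by auto
  define KU where "KU = {k\<in>K. 0 < n k \<bullet> v}"
  define KL where "KL = {k\<in>K. n k \<bullet> v < 0}"
  have KUL: "K = KU \<union> KL" using generic by (auto simp: KU_def KL_def not_less_iff_gr_or_eq)
  have U: "finite KU" "KU \<noteq> {}" and L: "finite KL" "KL \<noteq> {}"
    using K no_recession[of v] no_recession[of "- v"] v by (auto simp: KU_def KL_def)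
  define m where "m k = slope v (n k)" for k
  define b where "b k = c k / (n k \<bullet> v)" for k
  define g1 where "g1 a = Max ((\<lambda>k. m k * a + b k) ` KL)" for a
  define h where "h a = Max ((\<lambda>k. (- m k) * a + (- b k)) ` KU)" for a
  define g2 where "g2 a = - h a" for a
  have g1: "g1 a \<le> y \<longleftrightarrow> (\<forall>k\<in>KL. m k * a + b k \<le> y)"
    "g1 a < y \<longleftrightarrow> (\<forall>k\<in>KL. m k * a + b k < y)" for a y
    unfolding g1_def using L by auto
  have "h a \<le> - y \<longleftrightarrow> (\<forall>k\<in>KU. y \<le> m k * a + b k)"
    "h a < - y \<longleftrightarrow> (\<forall>k\<in>KU. y < m k * a + b k)" for a y
    unfolding h_def using U by (auto simp: algebra_simps)
  then have g2: "y \<le> g2 a \<longleftrightarrow> (\<forall>k\<in>KU. y \<le> m k * a + b k)"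
    "y < g2 a \<longleftrightarrow> (\<forall>k\<in>KU. y < m k * a + b k)" for a y
    unfolding g2_def by (simp_all add: le_minus_iff less_minus_iff)
  have le: "(\<forall>k\<in>K. n k \<bullet> pt v a y \<le> c k) \<longleftrightarrow> g1 a \<le> y \<and> y \<le> g2 a" for a y
    unfolding KUL ball_Un g1 g2
    by (simp add: KU_def KL_def m_def b_def halfspace_lower halfspace_upper conj_commute cong: ball_cong)
  have less: "(\<forall>k\<in>K. n k \<bullet> pt v a y < c k) \<longleftrightarrow> g1 a < y \<and> y < g2 a" for a y
    unfolding KUL ball_Un g1 g2
    by (simp add: KU_def KL_def m_def b_def halfspace_lower halfspace_upper conj_commute cong: ball_cong)
  \<comment> \<open>A pair consists of an upper and a lower boundary line, and
    \<open>?m p * a + ?b p\<close> is the vertical gap between them. Thus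
    \<open>g1 a \<le> g2 a\<close> becomes a finite system of affine inequalities in
    \<open>a\<close>.\<close>
  let ?m = "\<lambda>p. m (fst p) - m (snd p)" and ?b = "\<lambda>p. b (fst p) - b (snd p)"
  obtain a0 y0 where "x0 = pt v a0 y0" using pt_surj v by blast
  then have a0: "g1 a0 < y0" "y0 < g2 a0" using x0 less[of a0 y0] by auto
  have inner: "n k \<bullet> pt v a y = (y - m k * a) * (n k \<bullet> v)" if "k \<in> K" for k a y
    using inner_pt_slope generic[OF that] by (simp add: m_def)
  have ray: "\<exists>k\<in>K. 0 < (y - m k * a) * (n k \<bullet> v)" if "a \<noteq> 0" for a y
  proof -
    have "pt v a y \<noteq> pt v 0 0" using that v by (simp add: pt_eq_iff)
    then have "pt v a y \<noteq> 0" by (simp add: pt_def)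
    from no_recession[OF this] show ?thesis using inner by auto
  qed
  \<comment> \<open>If no upper slope exceeded a lower one, a slope \<open>q\<close> between them
    would give the recession direction \<open>pt v (- 1) (- q)\<close>. For the opposite sign the
    direction is \<open>pt v 1 q\<close>.\<close>
  have "\<exists>p\<in>KU \<times> KL. 0 < ?m p"
  proof (rule ccontr)
    assume "\<not> ?thesis"
    then have sep: "m k \<le> m l" if "k \<in> KU" "l \<in> KL" for k l using that by force
    define q where "q = Max (m ` KU)"
    have "m k \<le> q" if "k \<in> KU" for k using that U by (simp add: q_def)
    moreover have "q \<le> m l" if "l \<in> KL" for l using that U sep by (simp add: q_def)
    moreover obtain k where k: "k \<in> KU \<or> k \<in> KL" "0 < (- q + m k) * (n k \<bullet> v)"
      using ray[of "- 1" "- q"] by (auto simp: KUL)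
    ultimately have "- q + m k \<le> 0 \<and> 0 < n k \<bullet> v \<or> 0 \<le> - q + m k \<and> n k \<bullet> v < 0"
      by (auto simp: KU_def KL_def)
    with k(2) show False by (auto simp: zero_less_mult_iff)
  qed
  moreover have "\<exists>p\<in>KU \<times> KL. ?m p < 0"
  proof (rule ccontr)
    assume "\<not> ?thesis"
    then have sep: "m l \<le> m k" if "k \<in> KU" "l \<in> KL" for k l using that by force
    define q where "q = Min (m ` KU)"
    have "q \<le> m k" if "k \<in> KU" for k using that U by (simp add: q_def)
    moreover have "m l \<le> q" if "l \<in> KL" for l using that U sep by (simp add: q_def)
    moreover obtain k where k: "k \<in> KU \<or> k \<in> KL" "0 < (q - m k) * (n k \<bullet> v)"
      using ray[of 1 q] by (auto simp: KUL)
    ultimately have "q - m k \<le> 0 \<and> 0 < n k \<bullet> v \<or> 0 \<le> q - m k \<and> n k \<bullet> v < 0"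
      by (auto simp: KU_def KL_def)
    with k(2) show False by (auto simp: zero_less_mult_iff)
  qed
  moreover have pair_le: "(\<forall>p\<in>KU \<times> KL. 0 \<le> ?m p * a + ?b p) \<longleftrightarrow> g1 a \<le> g2 a" for a
    by (auto simp: g1 g2 algebra_simps)
  moreover have pair_less: "(\<forall>p\<in>KU \<times> KL. 0 < ?m p * a + ?b p) \<longleftrightarrow> g1 a < g2 a" for a
    by (auto simp: g1 g2 algebra_simps)
  moreover have "0 < ?m p * a0 + ?b p" if "p \<in> KU \<times> KL" for p
    using pair_less[of a0] a0 that by auto
  ultimately obtain \<alpha> \<beta> where ab: "\<alpha> < \<beta>"
    "\<And>a. g1 a \<le> g2 a \<longleftrightarrow> \<alpha> \<le> a \<and> a \<le> \<beta>" "\<And>a. g1 a < g2 a \<longleftrightarrow> \<alpha> < a \<and> a < \<beta>"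
    using affine_nonneg_interval[of "KU \<times> KL" ?m a0 ?b] U(1) L(1) by (simp only: finite_cartesian_product) metis
  have eq: "g1 \<alpha> = g2 \<alpha>" "g1 \<beta> = g2 \<beta>"
    using ab(2)[of \<alpha>] ab(3)[of \<alpha>] ab(2)[of \<beta>] ab(3)[of \<beta>] ab(1) by auto
  \<comment> \<open>The curve follows the upper graph as far as \<beta> and returns along the lower
    one at abscissa \<open>2 * \<beta> - t\<close>, closing up at
    \<open>2 * \<beta> - \<alpha>\<close>.\<close>
  define A where "A t = (if t \<le> \<beta> then t else 2 * \<beta> - t)" for t
  define Y where "Y t = (if t \<le> \<beta> then g2 t else g1 (2 * \<beta> - t))" for t
  define G where "G t = pt v (A t) (Y t)" for t
  have "piecewise_affine g1" "piecewise_affine h"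
    unfolding g1_def h_def using L U by (intro piecewise_affine_Max; simp)+
  then have "piecewise_affine (\<lambda>t. 0 + t *\<^sub>R perp v + g1 t *\<^sub>R v)"
    "piecewise_affine (\<lambda>t. 0 + t *\<^sub>R perp v + h t *\<^sub>R (- v))"
    by (intro piecewise_affine_curve; simp)+
  then have "piecewise_affine (\<lambda>t. pt v t (g1 t))" "piecewise_affine (\<lambda>t. pt v t (g2 t))"
    by (simp_all add: pt_def g2_def)
  then have "piecewise_affine (\<lambda>t. if t \<le> \<beta> then pt v t (g2 t) else pt v (2 * \<beta> - t) (g1 (2 * \<beta> - t)))"
    using eq by (intro piecewise_affine_if piecewise_affine_reflect) auto
  also have "(\<lambda>t. if t \<le> \<beta> then pt v t (g2 t) else pt v (2 * \<beta> - t) (g1 (2 * \<beta> - t))) = G"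
    by (auto simp: G_def A_def Y_def fun_eq_iff)
  finally have "piecewise_affine G" .
  moreover have "\<alpha> < 2 * \<beta> - \<alpha>" using ab(1) by simp
  moreover have "inj_on G {\<alpha><..<2 * \<beta> - \<alpha>}"
  proof -
    \<comment> \<open>Over the open interval the two graphs are disjoint, so a point of the way out
      never recurs on the way back.\<close>
    have False if "\<alpha> < t" "t \<le> \<beta>" "\<beta> < t'" "A t = A t'" "Y t = Y t'" for t t'
      using that ab(3)[of t] by (auto simp: A_def Y_def)
    moreover have "t = t'" if "A t = A t'" "t \<le> \<beta> \<longleftrightarrow> t' \<le> \<beta>" for t t'
      using that by (auto simp: A_def split: if_splits)
    ultimately show ?thesis
      unfolding inj_on_def G_def pt_eq_iff[OF v] by (metis greaterThanLessThan_iff not_le)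
  qed
  ultimately have "polygonal_chain (G ` {\<alpha>..2 * \<beta> - \<alpha>})" by (rule polygonal_chain_closed)
  moreover have "frontier {x. \<forall>k\<in>K. n k \<bullet> x \<le> c k} = G ` {\<alpha>..2 * \<beta> - \<alpha>}"
  proof (rule set_eqI)
    fix x
    obtain a y where x: "x = pt v a y" using pt_surj v by blast
    have "x \<in> frontier {x. \<forall>k\<in>K. n k \<bullet> x \<le> c k} \<longleftrightarrow>
        (\<forall>k\<in>K. n k \<bullet> pt v a y \<le> c k) \<and> \<not> (\<forall>k\<in>K. n k \<bullet> pt v a y < c k)"
      by (auto simp: frontier_halfspaces[OF K nz] x less_le)
    also have "\<dots> \<longleftrightarrow> (g1 a \<le> y \<and> y \<le> g2 a) \<and> \<not> (g1 a < y \<and> y < g2 a)"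
      unfolding le less ..
    also have "\<dots> \<longleftrightarrow> \<alpha> \<le> a \<and> a \<le> \<beta> \<and> (y = g2 a \<or> y = g1 a)"
      using ab(2)[of a] by auto
    also have "\<dots> \<longleftrightarrow> (\<exists>t\<in>{\<alpha>..2 * \<beta> - \<alpha>}. a = A t \<and> y = Y t)"
    proof
      assume "\<alpha> \<le> a \<and> a \<le> \<beta> \<and> (y = g2 a \<or> y = g1 a)"
      then consider "\<alpha> \<le> a" "a \<le> \<beta>" "y = g2 a" | "\<alpha> \<le> a" "a < \<beta>" "y = g1 a"
        using eq by fastforce
      then show "\<exists>t\<in>{\<alpha>..2 * \<beta> - \<alpha>}. a = A t \<and> y = Y t"
      proof cases
        case 1
        then show ?thesis by (intro bexI[of _ a]) (auto simp: A_def Y_def)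
      next
        case 2
        then show ?thesis by (intro bexI[of _ "2 * \<beta> - a"]) (auto simp: A_def Y_def)
      qed
    qed (auto simp: A_def Y_def split: if_splits)
    also have "\<dots> \<longleftrightarrow> x \<in> G ` {\<alpha>..2 * \<beta> - \<alpha>}"
      using v by (auto simp: x G_def pt_eq_iff image_iff)
    finally show "x \<in> frontier {x. \<forall>k\<in>K. n k \<bullet> x \<le> c k} \<longleftrightarrow> x \<in> G ` {\<alpha>..2 * \<beta> - \<alpha>}" .
  qed
  ultimately show ?thesis by simp
qed

text \<open>For \<open>v = (1, q)\<close> each normal excludes at most one \<open>q\<close>. If its
  second coordinate is 0, the quotient is 0 by convention and the product with \<open>v\<close> is
  the nonzero first coordinate.\<close>

lemma generic_direction:
  fixes n :: "'k \<Rightarrow> real^2"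
  assumes "finite K" "\<And>k. k \<in> K \<Longrightarrow> n k \<noteq> 0"
  obtains v where "v \<noteq> 0" "\<And>k. k \<in> K \<Longrightarrow> n k \<bullet> v \<noteq> 0"
proof -
  obtain q where q: "q \<notin> (\<lambda>k. - (n k $ 1) / n k $ 2) ` K"
    using ex_new_if_finite[OF infinite_UNIV_char_0] assms(1) by blast
  let ?v = "vector [1, q] :: real^2"
  show thesis
  proof
    show "?v \<noteq> 0" by (auto simp: vec_eq_iff forall_2)
    fix k assume k: "k \<in> K"
    then have "n k $ 1 \<noteq> 0 \<or> n k $ 2 \<noteq> 0" using assms(2) by (auto simp: vec_eq_iff forall_2)
    moreover have "q \<noteq> - (n k $ 1) / n k $ 2" using q k by blast
    ultimately show "n k \<bullet> ?v \<noteq> 0"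
      by (cases "n k $ 2 = 0") (auto simp: inner_vec_def sum_2 field_simps add_eq_0_iff)
  qed
qed

text \<open>For small positive \<open>e\<close>, strict inequalities at \<open>v\<close> persist by
  continuity, and the tight ones become strict because \<open>w\<close> decreases them.\<close>

lemma tilted_recession:
  fixes n :: "'k \<Rightarrow> 'a::real_inner"
  assumes "finite K" "\<And>k. k \<in> K \<Longrightarrow> n k \<bullet> v \<le> 0"
    and "\<And>k. k \<in> K \<Longrightarrow> n k \<bullet> v = 0 \<Longrightarrow> n k \<bullet> w < 0"
  obtains e where "\<And>k. k \<in> K \<Longrightarrow> n k \<bullet> (v + e *\<^sub>R w) < 0"
proof -
  have "eventually (\<lambda>e. n k \<bullet> (v + e *\<^sub>R w) < 0) (at_right 0)" if k: "k \<in> K" for k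
  proof (cases "n k \<bullet> v = 0")
    case True
    have "eventually (\<lambda>e::real. 0 < e) (at_right 0)" by (rule eventually_at_right_less)
    then show ?thesis
      by eventually_elim
        (use True assms(3)[OF k True] in \<open>simp add: inner_add_right mult_pos_neg\<close>)
  next
    case False
    have "((\<lambda>e. n k \<bullet> (v + e *\<^sub>R w)) \<longlongrightarrow> n k \<bullet> (v + 0 *\<^sub>R w)) (at_right 0)"
      by (intro tendsto_intros)
    then show ?thesis
      using False assms(2)[OF k] by (intro order_tendstoD(2)) (auto simp: less_le)
  qed
  then have "eventually (\<lambda>e. \<forall>k\<in>K. n k \<bullet> (v + e *\<^sub>R w) < 0) (at_right 0)"
    using assms(1) by (simp add: eventually_ball_finite)
  then obtain e where "\<forall>k\<in>K. n k \<bullet> (v + e *\<^sub>R w) < 0"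
    using eventually_happens' trivial_limit_at_right_real by blast
  then show thesis using that by blast
qed

text \<open>Without the spanning hypothesis the region may be a strip, whose boundary is disconnected.\<close>

lemma polygonal_chain_frontier_halfspaces:
  fixes n :: "'k \<Rightarrow> real^2"
  assumes K: "finite K" and nz: "\<And>k. k \<in> K \<Longrightarrow> n k \<noteq> 0"
    and x0: "\<And>k. k \<in> K \<Longrightarrow> n k \<bullet> x0 < c k"
    and span: "\<And>w. w \<noteq> 0 \<Longrightarrow> \<exists>k\<in>K. n k \<bullet> w \<noteq> 0"
  shows "polygonal_chain (frontier {x. \<forall>k\<in>K. n k \<bullet> x \<le> c k})"
proof (cases "\<exists>v. \<forall>k\<in>K. n k \<bullet> v < 0")
  case True
  then obtain v where v: "\<And>k. k \<in> K \<Longrightarrow> n k \<bullet> v < 0" by blast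
  have "axis 1 1 \<noteq> (0 :: real^2)" by (simp add: axis_eq_0_iff)
  then have "K \<noteq> {}" using span by blast
  with K v show ?thesis by (intro polygonal_chain_graph)
next
  case no_interior: False
  show ?thesis
  proof (cases "\<exists>v. v \<noteq> 0 \<and> (\<forall>k\<in>K. n k \<bullet> v \<le> 0)")
    case True
    then obtain v where v: "v \<noteq> 0" "\<And>k. k \<in> K \<Longrightarrow> n k \<bullet> v \<le> 0" by blast
    have perp: "n k \<bullet> perp v \<noteq> 0" if "k \<in> K" "n k \<bullet> v = 0" for k
      using nonzero_inner_perp v(1) nz that by blast
    \<comment> \<open>If \<open>w\<close> were not blocked by a vertical constraint, tilting
      \<open>v\<close> towards \<open>w\<close> would produce a direction in the interior of the
      recession cone.\<close>
    have opposite: "\<exists>k\<in>K. n k \<bullet> v = 0 \<and> 0 < n k \<bullet> w" if w: "w = perp v \<or> w = - perp v" for w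
    proof (rule ccontr)
      assume "\<not> ?thesis"
      then have "n k \<bullet> w < 0" if "k \<in> K" "n k \<bullet> v = 0" for k
        using that perp[OF that] w by force
      with K v(2) obtain e where "\<And>k. k \<in> K \<Longrightarrow> n k \<bullet> (v + e *\<^sub>R w) < 0"
        using tilted_recession[of K n v w] by blast
      then show False using no_interior by blast
    qed
    show ?thesis
    proof (rule polygonal_chain_half_strip[OF K nz x0 v(2)])
      \<comment> \<open>Otherwise \<open>v\<close> would be orthogonal to all normals and the region
        would contain a line.\<close>
      show "\<exists>k\<in>K. n k \<bullet> v < 0" using span[OF v(1)] v(2) by (force simp: less_le)
      show "\<exists>k\<in>K. n k \<bullet> v = 0 \<and> n k \<bullet> perp v < 0" using opposite[of "- perp v"] by simp
      show "\<exists>k\<in>K. n k \<bullet> v = 0 \<and> 0 < n k \<bullet> perp v" using opposite[of "perp v"] by simp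
    qed
  next
    case False
    then have "\<exists>k\<in>K. 0 < n k \<bullet> w" if "w \<noteq> 0" for w using that by (meson not_less)
    moreover obtain v where v: "v \<noteq> 0" "\<And>k. k \<in> K \<Longrightarrow> n k \<bullet> v \<noteq> 0"
      using generic_direction[of K n] K nz by metis
    ultimately show ?thesis by (intro polygonal_chain_bounded[OF K x0 v])
  qed
qed

section \<open>Cells of the weighted sides\<close>

locale clockwise_polygon =
  fixes s :: nat and p :: "nat \<Rightarrow> real^2"
  assumes clockwise: "clockwise_convex_polygon s p"
begin

definition nxt :: "nat \<Rightarrow> nat" where
  "nxt i = (i + 1) mod s"

text \<open>The interior of a clockwise polygon is to the right of each directed side, and
  \<open>perp\<close> is the clockwise quarter turn. The normal has the length of the side.\<close>

definition inward :: "nat \<Rightarrow> real^2" where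
  "inward i = perp (p (nxt i) - p i)"

definition side :: "nat \<Rightarrow> real^2 \<Rightarrow> real" where
  "side i x = inward i \<bullet> (x - p i)"

lemma s_ge_3: "3 \<le> s"
  using clockwise by (simp add: clockwise_convex_polygon_def)

lemma nxt_eq: "i < s \<Longrightarrow> nxt i = (if i = s - 1 then 0 else i + 1)"
  using s_ge_3 by (auto simp: nxt_def)

lemma nxt_less: "i < s \<Longrightarrow> nxt i < s"
  by (auto simp: nxt_eq)

lemma nxt_neq: "i < s \<Longrightarrow> nxt i \<noteq> i" "i < s \<Longrightarrow> i \<noteq> nxt i"
  using s_ge_3 by (auto simp: nxt_eq)

lemma nxt_nxt_neq: "i < s \<Longrightarrow> nxt (nxt i) \<noteq> i" "i < s \<Longrightarrow> i \<noteq> nxt (nxt i)"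
  using s_ge_3 by (auto simp: nxt_eq nxt_less)

lemma nxt_surj:
  assumes "i < s"
  obtains h where "h < s" "nxt h = i"
proof (cases "i = 0")
  case True
  then show ?thesis using s_ge_3 by (intro that[of "s - 1"]) (auto simp: nxt_eq)
next
  case False
  then show ?thesis using assms by (intro that[of "i - 1"]) (auto simp: nxt_eq)
qed

lemma side_orient: "side i x = - orient (p i) (p (nxt i)) x"
  by (simp add: side_def inward_def perp_def orient_def inner_vec_def sum_2 algebra_simps)

lemma side_add: "side i (x + y) = side i x + inward i \<bullet> y"
  by (simp add: side_def inner_add_right inner_diff_right)

lemma side_first: "side i (p i) = 0"
  by (simp add: side_def)

lemma side_second: "side i (p (nxt i)) = 0"
  by (simp add: side_def inward_def inner_perp)

lemma side_other: "i < s \<Longrightarrow> j < s \<Longrightarrow> j \<noteq> i \<Longrightarrow> j \<noteq> nxt i \<Longrightarrow> 0 < side i (p j)"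
  using clockwise by (auto simp: clockwise_convex_polygon_def side_orient nxt_def)

lemma side_vertex: "i < s \<Longrightarrow> j < s \<Longrightarrow> 0 \<le> side i (p j)"
  using side_other[of i j] side_first[of i] side_second[of i] by (metis less_imp_le order_refl)

lemma inward_nonzero:
  assumes "i < s"
  shows "inward i \<noteq> 0"
proof
  assume "inward i = 0"
  then have "side i (p (nxt (nxt i))) = 0" by (simp add: side_def)
  moreover have "0 < side i (p (nxt (nxt i)))"
    using assms by (intro side_other) (auto simp: nxt_less nxt_neq nxt_nxt_neq)
  ultimately show False by simp
qed

lemma vertex_neq:
  assumes "i < s"
  shows "p i \<noteq> p (nxt i)"
  using inward_nonzero[OF assms] by (auto simp: inward_def perp_def vec_eq_iff forall_2)

lemma polygon_subset_halfplane:
  assumes "i < s"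
  shows "polygon s p \<subseteq> {x. inward i \<bullet> x \<ge> inward i \<bullet> p i}"
  unfolding polygon_def
proof (rule hull_minimal)
  show "p ` {..<s} \<subseteq> {x. inward i \<bullet> x \<ge> inward i \<bullet> p i}"
    using side_vertex[OF assms] by (auto simp: side_def inner_diff_right)
qed (rule convex_halfspace_ge)

lemma side_interior_pos:
  assumes "i < s" "x \<in> interior (polygon s p)"
  shows "0 < side i x"
proof -
  have "x \<in> interior {x. inward i \<bullet> x \<ge> inward i \<bullet> p i}"
    using interior_mono[OF polygon_subset_halfplane[OF assms(1)]] assms(2) by blast
  then show ?thesis
    using inward_nonzero[OF assms(1)] by (simp add: side_def inner_diff_right)
qed

text \<open>A vertex \<open>p k\<close> that minimises a separating functional spans, with its two neighbours, a cone
  containing \<open>x\<close>; so the functional is no smaller at \<open>x\<close>.\<close>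

lemma mem_polygonI:
  assumes x: "\<And>i. i < s \<Longrightarrow> 0 \<le> side i x"
  shows "x \<in> polygon s p"
proof (rule ccontr)
  assume out: "x \<notin> polygon s p"
  have "closed (polygon s p)" "convex (polygon s p)"
    by (simp_all add: polygon_def compact_imp_closed finite_imp_compact_convex_hull)
  then obtain a b where ab: "a \<bullet> x < b" "\<forall>z\<in>polygon s p. b < a \<bullet> z"
    using separating_hyperplane_closed_point out by blast
  have "{..<s} \<noteq> {}" using s_ge_3 by (simp add: lessThan_empty_iff)
  then obtain k where k: "k < s" "\<And>j. j < s \<Longrightarrow> a \<bullet> p k \<le> a \<bullet> p j"
    using ex_is_arg_min_if_finite[of "{..<s}" "\<lambda>j. a \<bullet> p j"] by (auto simp: is_arg_min_linorder)
  obtain h where h: "h < s" "nxt h = k" using nxt_surj k(1) by blast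
  define u where "u = p (nxt k) - p k"
  define w where "w = p h - p k"
  define z where "z = x - p k"
  have au: "0 \<le> a \<bullet> u" and aw: "0 \<le> a \<bullet> w"
    using k h(1) nxt_less by (simp_all add: u_def w_def inner_diff_right)
  have zu: "0 \<le> perp u \<bullet> z"
    using x[OF k(1)] by (simp add: side_def inward_def u_def z_def)
  have zw: "perp w \<bullet> z \<le> 0"
    using x[OF h(1)]
    by (simp add: side_def inward_def h w_def z_def perp_def inner_vec_def sum_2 algebra_simps)
  have "0 < side k (p h)"
    using k(1) h nxt_neq nxt_nxt_neq by (intro side_other) auto
  then have D: "0 < perp u \<bullet> w" by (simp add: side_def inward_def u_def w_def)
  \<comment> \<open>This is Cramer's rule for \<open>z\<close> in the basis \<open>u\<close>,
    \<open>w\<close> of the two edges at \<open>p k\<close>; by \<open>zu\<close>, \<open>zw\<close>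
    and \<open>D\<close> both coordinates are nonnegative.\<close>
  have "(perp u \<bullet> w) *\<^sub>R z = (perp u \<bullet> z) *\<^sub>R w - (perp w \<bullet> z) *\<^sub>R u"
    by (simp add: perp_def vec_eq_iff forall_2 inner_vec_def sum_2 algebra_simps)
  then have "a \<bullet> ((perp u \<bullet> w) *\<^sub>R z) = (perp u \<bullet> z) * (a \<bullet> w) - (perp w \<bullet> z) * (a \<bullet> u)"
    by (simp add: inner_diff_right)
  also have "\<dots> \<ge> 0"
    using mult_nonneg_nonneg[OF zu aw] mult_nonpos_nonneg[OF zw au] by simp
  finally have "0 \<le> a \<bullet> z" using D by (simp add: zero_le_mult_iff)
  then have "a \<bullet> p k \<le> a \<bullet> x" by (simp add: z_def inner_diff_right)
  moreover have "p k \<in> polygon s p" using k(1) by (auto simp: polygon_def intro: hull_inc)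
  ultimately show False using ab by force
qed

lemma exterior_side_neg:
  assumes "x \<notin> polygon s p"
  shows "\<exists>i<s. side i x < 0"
  using assms mem_polygonI by (meson not_less)

lemma no_recession_direction:
  assumes "w \<noteq> 0"
  shows "\<exists>i<s. inward i \<bullet> w < 0"
proof (rule ccontr)
  assume "\<not> ?thesis"
  then have w: "0 \<le> inward i \<bullet> w" if "i < s" for i using that by (meson not_less)
  have "compact (polygon s p)"
    by (simp add: polygon_def finite_imp_compact_convex_hull)
  then obtain b where b: "\<And>x. x \<in> polygon s p \<Longrightarrow> norm x \<le> b"
    using compact_imp_bounded bounded_iff by metis
  have "p 0 \<in> polygon s p" using s_ge_3 by (auto simp: polygon_def intro: hull_inc)
  from b[OF this] have "0 \<le> b" using norm_ge_zero order_trans by blast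
  \<comment> \<open>The displacement \<open>q *\<^sub>R w\<close> gets length
    \<open>b + norm (p 0) + 1\<close>, by 1 more than the triangle inequality allows inside the ball
    of radius \<open>b\<close>.\<close>
  define q where "q = (b + norm (p 0) + 1) / norm w"
  have q: "0 \<le> q" "q * norm w = b + norm (p 0) + 1"
    using assms \<open>0 \<le> b\<close> by (auto simp: q_def)
  have "0 \<le> side i (p 0 + q *\<^sub>R w)" if "i < s" for i
    using side_vertex[OF that, of 0] w[OF that] q(1) s_ge_3 by (simp add: side_add)
  then have "norm (p 0 + q *\<^sub>R w) \<le> b" by (intro b mem_polygonI)
  moreover have "norm (q *\<^sub>R w) \<le> norm (p 0 + q *\<^sub>R w) + norm (p 0)"
    using norm_triangle_ineq4[of "p 0 + q *\<^sub>R w" "p 0"] by simp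
  ultimately show False using q by simp
qed

section \<open>The regions belonging to a choice of weights\<close>

definition cell :: "(nat \<Rightarrow> real) \<Rightarrow> nat \<Rightarrow> (real^2) set" where
  "cell t i = {x. \<forall>j<s. t i * side i x \<le> t j * side j x}"

context
  fixes t :: "nat \<Rightarrow> real"
  assumes t_pos: "\<And>i. 0 < t i"
begin

text \<open>The index \<open>i\<close> is left out, because its constraint is trivial and would have
  normal 0.\<close>

lemma cell_halfspaces:
  "cell t i = {x. \<forall>j\<in>{..<s} - {i}. (t i *\<^sub>R inward i - t j *\<^sub>R inward j) \<bullet> x
      \<le> t i * (inward i \<bullet> p i) - t j * (inward j \<bullet> p j)}"
  by (auto simp: cell_def side_def inner_diff_left inner_diff_right algebra_simps)

text \<open>With equal weighted normals the two weighted side functions would differ by a constant.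
  Comparing their values at \<open>p i\<close> and \<open>p j\<close> forces both ends of side
  \<open>j\<close> onto the line of side \<open>i\<close>, which is impossible for distinct
  sides.\<close>

lemma cell_normal_nonzero:
  assumes "i < s" "j < s" "j \<noteq> i"
  shows "t i *\<^sub>R inward i - t j *\<^sub>R inward j \<noteq> 0"
proof
  assume "t i *\<^sub>R inward i - t j *\<^sub>R inward j = 0"
  then have "(t i *\<^sub>R inward i) \<bullet> (x - y) = (t j *\<^sub>R inward j) \<bullet> (x - y)" for x y by simp
  then have eq: "t i * side i x - t i * side i y = t j * side j x - t j * side j y" for x y
    by (simp add: side_def inner_diff_right algebra_simps)
  have nonneg: "0 \<le> t k * side k (p l)" if "k < s" "l < s" for k l
    using side_vertex[OF that] t_pos[of k] by simp
  have "t i * side i (p j) = 0"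
    using eq[of "p j" "p i"] nonneg[of i j] nonneg[of j i] assms by (simp add: side_first)
  moreover from this have "t i * side i (p (nxt j)) = 0"
    using eq[of "p (nxt j)" "p j"] by (auto simp: side_first side_second)
  ultimately have "side i (p j) = 0" "side i (p (nxt j)) = 0" using t_pos[of i] by auto
  then have "j = nxt i" "nxt j = i \<or> nxt j = nxt i"
    using side_other[of i j] side_other[of i "nxt j"] assms by (auto simp: nxt_less)
  then show False using assms by (auto simp: nxt_nxt_neq nxt_neq nxt_less)
qed

text \<open>The midpoint of side \<open>i\<close> works: its own side function vanishes there, and
  all others are positive, since no other side contains both ends of side \<open>i\<close>.\<close>

lemma cell_slater:
  assumes "i < s"
  shows "\<exists>x. \<forall>j\<in>{..<s} - {i}. (t i *\<^sub>R inward i - t j *\<^sub>R inward j) \<bullet> x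
      < t i * (inward i \<bullet> p i) - t j * (inward j \<bullet> p j)"
proof -
  define x where "x = (1/2) *\<^sub>R (p i + p (nxt i))"
  have mid: "side j x = (side j (p i) + side j (p (nxt i))) / 2" for j
    by (simp add: x_def side_def inner_diff_right inner_add_right field_simps)
  have "t i * side i x < t j * side j x" if j: "j < s" "j \<noteq> i" for j
  proof -
    have "0 < side j (p i) \<or> 0 < side j (p (nxt i))"
    proof (rule ccontr)
      assume "\<not> ?thesis"
      then have "i = nxt j" "nxt i = j \<or> nxt i = nxt j"
        using side_other[of j i] side_other[of j "nxt i"] assms j by (auto simp: nxt_less)
      then show False using j by (auto simp: nxt_nxt_neq nxt_neq nxt_less)
    qed
    then have "0 < side j x"
      using side_vertex[OF j(1) assms] side_vertex[OF j(1) nxt_less[OF assms]] by (auto simp: mid)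
    moreover have "side i x = 0" by (simp add: mid side_first side_second)
    ultimately show ?thesis using t_pos[of j] by simp
  qed
  then have "\<forall>j\<in>{..<s} - {i}. (t i *\<^sub>R inward i - t j *\<^sub>R inward j) \<bullet> x
      < t i * (inward i \<bullet> p i) - t j * (inward j \<bullet> p j)"
    by (auto simp: side_def inner_diff_left inner_diff_right algebra_simps)
  then show ?thesis ..
qed

text \<open>If \<open>w\<close> were orthogonal to all these normals, the values
  \<open>t j * (inward j \<bullet> w)\<close> would coincide; yet one is negative and, by the same
  fact for \<open>- w\<close>, one is positive.\<close>

lemma cell_normals_span:
  assumes i: "i < s" and w: "w \<noteq> 0"
  shows "\<exists>j\<in>{..<s} - {i}. (t i *\<^sub>R inward i - t j *\<^sub>R inward j) \<bullet> w \<noteq> 0"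
proof (rule ccontr)
  assume "\<not> ?thesis"
  then have eq: "t j * (inward j \<bullet> w) = t i * (inward i \<bullet> w)" if "j < s" for j
    using that by (cases "j = i") (auto simp: inner_diff_left)
  obtain j where j: "j < s" "inward j \<bullet> w < 0" using no_recession_direction w by blast
  obtain k where k: "k < s" "inward k \<bullet> (- w) < 0" using no_recession_direction[of "- w"] w by auto
  have "t j * (inward j \<bullet> w) < 0" "0 < t k * (inward k \<bullet> w)"
    using j(2) k(2) t_pos by (simp_all add: mult_pos_neg)
  then show False using eq[OF j(1)] eq[OF k(1)] by simp
qed

lemma closed_cell: "closed (cell t i)"
  unfolding cell_halfspaces by (rule closed_halfspaces)

lemma convex_cell: "convex (cell t i)"
  unfolding cell_halfspaces by (rule convex_halfspaces)

lemma interior_cell: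
  assumes "i < s"
  shows "interior (cell t i) = {x. \<forall>j\<in>{..<s} - {i}. t i * side i x < t j * side j x}"
proof -
  have "interior (cell t i) = {x. \<forall>j\<in>{..<s} - {i}. (t i *\<^sub>R inward i - t j *\<^sub>R inward j) \<bullet> x
      < t i * (inward i \<bullet> p i) - t j * (inward j \<bullet> p j)}"
    unfolding cell_halfspaces using cell_normal_nonzero[OF assms]
    by (intro interior_halfspaces) auto
  also have "\<dots> = {x. \<forall>j\<in>{..<s} - {i}. t i * side i x < t j * side j x}"
    by (auto simp: side_def inner_diff_left inner_diff_right algebra_simps)
  finally show ?thesis .
qed

lemma polygonal_region_cell:
  assumes "i < s"
  shows "polygonal_region (cell t i)"
proof -
  let ?U = "interior (cell t i)"
  have nz: "t i *\<^sub>R inward i - t j *\<^sub>R inward j \<noteq> 0" if "j \<in> {..<s} - {i}" for j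
    using cell_normal_nonzero[OF assms] that by auto
  obtain x where x: "\<forall>j\<in>{..<s} - {i}. (t i *\<^sub>R inward i - t j *\<^sub>R inward j) \<bullet> x
      < t i * (inward i \<bullet> p i) - t j * (inward j \<bullet> p j)"
    using cell_slater[OF assms] by blast
  then have "x \<in> ?U"
    unfolding cell_halfspaces using nz by (subst interior_halfspaces) auto
  then have ne: "?U \<noteq> {}" by blast
  then have "closure ?U = cell t i"
    using convex_closure_interior[OF convex_cell] closure_closed[OF closed_cell] by metis
  moreover have "connected ?U"
    using convex_connected convex_interior[OF convex_cell] by blast
  moreover have "polygonal_chain (frontier (cell t i))"
    unfolding cell_halfspaces
    by (rule polygonal_chain_frontier_halfspaces[of _ _ x])
      (use nz x cell_normals_span[OF assms] in auto)
  ultimately show ?thesis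
    unfolding polygonal_region_def using ne by (metis open_interior)
qed

text \<open>At such a vertex the weighted side functions of \<open>i\<close> and \<open>j\<close>
  tie at their least value 0: the tie keeps the vertex in the cell but out of its interior.\<close>

lemma vertex_in_cell_frontier:
  assumes ij: "i < s" "j < s" "j \<noteq> i" and k: "k < s" "side i (p k) = 0" "side j (p k) = 0"
  shows "p k \<in> frontier (cell t i)"
proof -
  have "p k \<in> cell t i"
    using side_vertex[OF _ k(1)] k(2) t_pos by (auto simp: cell_def less_imp_le)
  moreover have "p k \<notin> interior (cell t i)"
    using ij k(2,3) by (simp add: interior_cell[OF ij(1)] bexI[of _ j])
  ultimately show ?thesis by (simp add: frontier_def closure_closed closed_cell)
qed

lemma diagonal_cell:
  assumes "i < s"
  shows "diagonal (cell t i) (closed_segment (p i) (p (nxt i)))"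
proof -
  \<comment> \<open>At \<open>p i\<close> the tie is with the preceding side \<open>h\<close>, at
    \<open>p (nxt i)\<close> with the following side.\<close>
  obtain h where h: "h < s" "nxt h = i" using nxt_surj assms by blast
  have "p i \<in> frontier (cell t i)"
    using vertex_in_cell_frontier[of i h i] assms h nxt_neq(2)[of h] side_first[of i] side_second[of h]
    by auto
  moreover have "p (nxt i) \<in> frontier (cell t i)"
    using vertex_in_cell_frontier[of i "nxt i" "nxt i"] assms
    by (simp add: nxt_less nxt_neq side_first side_second)
  ultimately show ?thesis
    unfolding diagonal_def using vertex_neq[OF assms] by blast
qed

lemma convex_plane_partition_cells: "convex_plane_partition s (cell t)"
  unfolding convex_plane_partition_def
proof (intro conjI allI impI)
  have ne: "{..<s} \<noteq> {}" using s_ge_3 by (simp add: lessThan_empty_iff)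
  have "\<exists>i<s. x \<in> cell t i" for x
    using ex_is_arg_min_if_finite[of "{..<s}" "\<lambda>i. t i * side i x"] ne
    by (auto simp: is_arg_min_linorder cell_def)
  then show "(\<Union>i<s. cell t i) = UNIV" by blast
next
  fix i j assume ij: "i < s" "j < s" "i \<noteq> j"
  have False if "x \<in> interior (cell t i)" "x \<in> interior (cell t j)" for x
  proof -
    have "t i * side i x < t j * side j x" "t j * side j x < t i * side i x"
      using that ij by (simp_all add: interior_cell)
    then show False by simp
  qed
  then show "interior (cell t i) \<inter> interior (cell t j) = {}" by blast
qed (simp_all add: polygonal_region_cell convex_cell)

end

end

theorem theorem3:
  fixes p :: "nat \<Rightarrow> real^2" and s :: nat and B R :: "(real^2) set"
  assumes "clockwise_convex_polygon s p"
    and "finite B" and "B \<subseteq> interior (polygon s p)"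
    and "finite R" and "R \<inter> polygon s p = {}"
    and "int s = int (card B) - int (card R)"
    and "general_position (R \<union> B \<union> p ` {..<s})"
  shows "\<exists>(Q :: nat \<Rightarrow> (real^2) set) (f :: real^2 \<Rightarrow> nat).
    convex_plane_partition s Q \<and>
    (\<forall>x \<in> R \<union> B. f x < s \<and> x \<in> Q (f x)) \<and>
    (\<forall>i<s. diagonal (Q i) (closed_segment (p i) (p ((i + 1) mod s))) \<and>
      int (card {b \<in> B. f b = i}) - int (card {r \<in> R. f r = i}) = 1)"
proof -
  interpret clockwise_polygon s p by standard (rule assms(1))
  have disj: "B \<inter> R = {}" using assms(3,5) interior_subset by blast
  have card: "card B = s + card R" using assms(6) by linarith
  have pos: "0 < side i b" if "i < s" "b \<in> B" for i b
    using that assms(3) side_interior_pos by blast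
  have neg: "\<exists>i<s. side i r < 0" if "r \<in> R" for r
    using that assms(5) exterior_side_neg by blast
  obtain t f where t: "\<forall>i. 0 < t i"
    and f: "\<forall>x\<in>R \<union> B. f x < s \<and> (\<forall>j<s. t (f x) * side (f x) x \<le> t j * side j x)"
      "\<forall>i<s. card {b\<in>B. f b = i} = card {r\<in>R. f r = i} + 1"
    using weighted_sides_assignment[OF assms(2,4) disj card pos neg] .
  have t_pos: "0 < t i" for i using t by blast
  show ?thesis
  proof (intro exI conjI ballI allI impI)
    show "convex_plane_partition s (cell t)" by (rule convex_plane_partition_cells[OF t_pos])
    fix x assume "x \<in> R \<union> B"
    then show "f x < s" "x \<in> cell t (f x)" using f(1) by (auto simp: cell_def)
  next
    fix i assume i: "i < s"
    show "diagonal (cell t i) (closed_segment (p i) (p ((i + 1) mod s)))"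
      using diagonal_cell[OF t_pos i] by (simp add: nxt_def)
    show "int (card {b \<in> B. f b = i}) - int (card {r \<in> R. f r = i}) = 1"
      using f(2) i by simp
  qed
qed

end
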